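(* Let $(G,E)$ be a connected simple graph with countably infinite vertex set and bounded degree, and $\mu$ a conductance on $E$ such that $(G,\mu)$ satisfies condition $(p_0)$ and $\mu$ satisfies $(\mathrm{VD})_R$, where $R$ is the effective resistance. If $\mathrm{diam}(G,R)=\infty$ and $V_R(x,s)<\infty$ for all $s>0$ and $x\in G$, then there exists a metric $d$ on $G$ that fits to $(G,E)$, is quasisymmetric to $R$, satisfies $d(x,y)\asymp1$ for $(x,y)\in E$, and for some $1\le\alpha<\beta$ satisfies: (DHK($\beta$)) $h_{2n}(x,x)\asymp 1/V_d(x,n^{1/\beta})$ for all $x\in G$, $n\ge1$; (ARL($\beta$)) there are $\lambda,C>0$ with $R(B_d(x,\lambda s),B_d(x,s)^c)V_d(x,s)\ge Cs^\beta$ for all $x$ and $s>r_x$; (BRU($\beta$)) there is $C'>0$ with $R(x,B_d(x,s)^c)V_d(x,s)\le C's^\beta$ for all $x$ and $s>r_x$; (VG($\alpha$)) there is $C''>0$ with $V_d(x,s)\le C''(s/t)^\alpha V_d(x,t)$ for all $x\in G$ and $s>t>0$.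
   Context: $\mu:E\to(0,\infty)$ symmetric; $\mu_x=\sum_{y\sim x}\mu_{xy}$, $\mu(A)=\sum_{x\in A}\mu_x$; $V_\rho(x,s)=\mu(B_\rho(x,s))$ for a metric $\rho$, $r_x=\inf_{y\ne x}d(x,y)$. Condition $(p_0)$: there is $p_0>0$ with $\mu_{xy}/\mu_x\ge p_0$ for all $x\sim y$. $(\mathrm{VD})_\rho$: there is $C>0$ with $V_\rho(x,2s)\le CV_\rho(x,s)$ for all $x$, $s>0$. Heat kernel: $p(x,y)=\mu_{xy}/\mu_x$, $p_n$ the $n$-step transition probabilities, $h_n(x,y)=p_n(x,y)/\mu_y$. Energy $\mathcal{E}(f)=\frac12\sum_{(x,y)\in E}(f(x)-f(y))^2\mu_{xy}$; $R(A,B)=(\inf\{\mathcal{E}(f):f|_A=1,f|_B=0\})^{-1}$, $R(x,y)=R(\{x\},\{y\})$ (a metric). Quasisymmetry: $d$ is quasisymmetric to $\rho$ if there is a homeomorphism $\theta$ of $[0,\infty)$ with $\rho(x,y)/\rho(x,z)\le\theta(d(x,y)/d(x,z))$ for all $x\ne z$. Fitting: (F1) there is $C>0$ with $d(x,y)\le Cd(x,z)$ whenever $x\sim y$, $x\ne z$; (F2) for every $\epsilon>0$ there exist $s>0$, $n\ge1$, $x_0,\dots,x_n$ with $x_i\in B_d(x_0,s)$ for $i<n$, $x_n\notin B_d(x_0,s)$, $x_i\sim x_{i-1}$, $d(x_i,x_{i-1})\le\epsilon s$. *)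

theory Defs
  imports "HOL-Analysis.Analysis"
begin

text \<open>Graphs: the vertex set is the whole type 'a; the edge relation is E (x \<sim> y iff E x y).
 Conductances are mu :: 'a \<Rightarrow> 'a \<Rightarrow> real; only values on edges are used.\<close>

definition simple_graph :: "('a \<Rightarrow> 'a \<Rightarrow> bool) \<Rightarrow> bool" where
  "simple_graph E \<longleftrightarrow> (\<forall>x y. E x y \<longrightarrow> E y x) \<and> (\<forall>x. \<not> E x x)"

definition connected_graph :: "('a \<Rightarrow> 'a \<Rightarrow> bool) \<Rightarrow> bool" where
  "connected_graph E \<longleftrightarrow> (\<forall>x y. E\<^sup>*\<^sup>* x y)"

definition bounded_degree :: "('a \<Rightarrow> 'a \<Rightarrow> bool) \<Rightarrow> bool" where
  "bounded_degree E \<longleftrightarrow> (\<exists>M::nat. \<forall>x. finite {y. E x y} \<and> card {y. E x y} \<le> M)"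

definition conductance :: "('a \<Rightarrow> 'a \<Rightarrow> bool) \<Rightarrow> ('a \<Rightarrow> 'a \<Rightarrow> real) \<Rightarrow> bool" where
  "conductance E mu \<longleftrightarrow> (\<forall>x y. E x y \<longrightarrow> mu x y > 0 \<and> mu x y = mu y x)"

definition mu_v :: "('a \<Rightarrow> 'a \<Rightarrow> bool) \<Rightarrow> ('a \<Rightarrow> 'a \<Rightarrow> real) \<Rightarrow> 'a \<Rightarrow> real" where
  "mu_v E mu x = (\<Sum>y\<in>{y. E x y}. mu x y)"

definition vol :: "('a \<Rightarrow> 'a \<Rightarrow> bool) \<Rightarrow> ('a \<Rightarrow> 'a \<Rightarrow> real) \<Rightarrow> 'a set \<Rightarrow> ennreal" where
  "vol E mu A = (\<integral>\<^sup>+ x. ennreal (mu_v E mu x) \<partial>count_space A)"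

definition is_metric :: "('a \<Rightarrow> 'a \<Rightarrow> real) \<Rightarrow> bool" where
  "is_metric \<rho> \<longleftrightarrow> (\<forall>x y. 0 \<le> \<rho> x y) \<and> (\<forall>x y. \<rho> x y = 0 \<longleftrightarrow> x = y)
     \<and> (\<forall>x y. \<rho> x y = \<rho> y x) \<and> (\<forall>x y z. \<rho> x z \<le> \<rho> x y + \<rho> y z)"

definition mball :: "('a \<Rightarrow> 'a \<Rightarrow> real) \<Rightarrow> 'a \<Rightarrow> real \<Rightarrow> 'a set" where
  "mball \<rho> x s = {y. \<rho> x y < s}"

definition Vball :: "('a \<Rightarrow> 'a \<Rightarrow> bool) \<Rightarrow> ('a \<Rightarrow> 'a \<Rightarrow> real) \<Rightarrow> ('a \<Rightarrow> 'a \<Rightarrow> real) \<Rightarrow> 'a \<Rightarrow> real \<Rightarrow> ennreal" where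
  "Vball E mu \<rho> x s = vol E mu (mball \<rho> x s)"

definition rmin :: "('a \<Rightarrow> 'a \<Rightarrow> real) \<Rightarrow> 'a \<Rightarrow> real" where
  "rmin d x = Inf {d x y | y. y \<noteq> x}"

definition trans_prob :: "('a \<Rightarrow> 'a \<Rightarrow> bool) \<Rightarrow> ('a \<Rightarrow> 'a \<Rightarrow> real) \<Rightarrow> 'a \<Rightarrow> 'a \<Rightarrow> real" where
  "trans_prob E mu x y = (if E x y then mu x y / mu_v E mu x else 0)"

fun pn :: "('a \<Rightarrow> 'a \<Rightarrow> bool) \<Rightarrow> ('a \<Rightarrow> 'a \<Rightarrow> real) \<Rightarrow> nat \<Rightarrow> 'a \<Rightarrow> 'a \<Rightarrow> real" where
  "pn E mu 0 x y = (if x = y then 1 else 0)"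
| "pn E mu (Suc n) x z = (\<Sum>y\<in>{y. E y z}. pn E mu n x y * trans_prob E mu y z)"

definition hk :: "('a \<Rightarrow> 'a \<Rightarrow> bool) \<Rightarrow> ('a \<Rightarrow> 'a \<Rightarrow> real) \<Rightarrow> nat \<Rightarrow> 'a \<Rightarrow> 'a \<Rightarrow> real" where
  "hk E mu n x y = pn E mu n x y / mu_v E mu y"

definition energy :: "('a \<Rightarrow> 'a \<Rightarrow> bool) \<Rightarrow> ('a \<Rightarrow> 'a \<Rightarrow> real) \<Rightarrow> ('a \<Rightarrow> real) \<Rightarrow> ennreal" where
  "energy E mu f = ennreal (1/2) *
     (\<integral>\<^sup>+ p. ennreal ((f (fst p) - f (snd p))^2 * mu (fst p) (snd p)) \<partial>count_space {(x,y). E x y})"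

definition eff_res :: "('a \<Rightarrow> 'a \<Rightarrow> bool) \<Rightarrow> ('a \<Rightarrow> 'a \<Rightarrow> real) \<Rightarrow> 'a set \<Rightarrow> 'a set \<Rightarrow> ennreal" where
  "eff_res E mu A B = inverse (Inf {energy E mu f | f. (\<forall>x\<in>A. f x = 1) \<and> (\<forall>x\<in>B. f x = 0)})"

text \<open>resistance metric R(x,y) = R({x},{y}) (finite on connected graphs)\<close>
definition res_metric :: "('a \<Rightarrow> 'a \<Rightarrow> bool) \<Rightarrow> ('a \<Rightarrow> 'a \<Rightarrow> real) \<Rightarrow> 'a \<Rightarrow> 'a \<Rightarrow> real" where
  "res_metric E mu x y = enn2real (eff_res E mu {x} {y})"

definition cond_p0 :: "('a \<Rightarrow> 'a \<Rightarrow> bool) \<Rightarrow> ('a \<Rightarrow> 'a \<Rightarrow> real) \<Rightarrow> bool" where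
  "cond_p0 E mu \<longleftrightarrow> (\<exists>p0>0. \<forall>x y. E x y \<longrightarrow> mu x y / mu_v E mu x \<ge> p0)"

definition VD :: "('a \<Rightarrow> 'a \<Rightarrow> bool) \<Rightarrow> ('a \<Rightarrow> 'a \<Rightarrow> real) \<Rightarrow> ('a \<Rightarrow> 'a \<Rightarrow> real) \<Rightarrow> bool" where
  "VD E mu \<rho> \<longleftrightarrow> (\<exists>C>0. \<forall>x s. s > 0 \<longrightarrow> Vball E mu \<rho> x (2 * s) \<le> ennreal C * (Vball E mu \<rho> x s))"

definition quasisymmetric :: "('a \<Rightarrow> 'a \<Rightarrow> real) \<Rightarrow> ('a \<Rightarrow> 'a \<Rightarrow> real) \<Rightarrow> bool" where
  "quasisymmetric d \<rho> \<longleftrightarrow> (\<exists>\<theta> \<theta>'. homeomorphism {0..} {0..} \<theta> \<theta>' \<and>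
      (\<forall>x y z. x \<noteq> z \<longrightarrow> \<rho> x y / \<rho> x z \<le> \<theta> (d x y / d x z)))"

definition fits :: "('a \<Rightarrow> 'a \<Rightarrow> real) \<Rightarrow> ('a \<Rightarrow> 'a \<Rightarrow> bool) \<Rightarrow> bool" where
  "fits d E \<longleftrightarrow>
     (\<exists>C>0. \<forall>x y z. E x y \<and> x \<noteq> z \<longrightarrow> d x y \<le> C * d x z) \<and>
     (\<forall>\<epsilon>>0. \<exists>s>0. \<exists>n\<ge>1. \<exists>xs :: nat \<Rightarrow> 'a.
        (\<forall>i<n. xs i \<in> mball d (xs 0) s) \<and> xs n \<notin> mball d (xs 0) s \<and>
        (\<forall>i\<in>{1..n}. E (xs i) (xs (i-1)) \<and> d (xs i) (xs (i-1)) \<le> \<epsilon> * s))"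

end

theory Submission
  imports Defs
begin

text \<open>
  Write \<open>V x r\<close> for the volume of the resistance ball and \<open>\<Phi> x r = r * V x r\<close>. The function
  \<open>q x y = \<Phi> x (R x y) + \<Phi> y (R x y)\<close> is a quasi-metric by volume doubling, so for large \<open>\<beta>\<close> its power
  \<open>q powr (1 / \<beta>)\<close> is comparable to a metric \<open>d\<close> (Frink). A \<open>d\<close>-ball of radius \<open>s\<close> is then comparable to
  a resistance ball of radius \<open>r\<close> with \<open>\<Phi> x r\<close> of order \<open>s powr \<beta>\<close>, which turns statements on \<open>d\<close> into
  statements on \<open>R\<close>. The resistance across an annulus of \<open>R\<close>-radius \<open>r\<close> is of order \<open>r\<close>, by a covering
  argument. Both heat kernel bounds come from the truncated Green function \<open>G = (\<Sum>k<n. h k x)\<close>: its energy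
  is at most \<open>G x\<close> and its mass at most \<open>n\<close>, whence \<open>G x \<le> 3 * r\<close> as soon as \<open>n \<le> \<Phi> x r\<close>. This
  gives the upper bound since \<open>h (2 * k) x x\<close> decreases in \<open>k\<close>; pairing \<open>G\<close> with a cutoff function of
  energy of order \<open>1 / r\<close> shows that the walk is in a ball of radius of order \<open>r\<close> at time \<open>n\<close> with
  probability at least one half, which gives the lower bound.
\<close>

subsection \<open>Metrization of quasi-metrics\<close>

definition chain_sum :: "('a \<Rightarrow> 'a \<Rightarrow> real) \<Rightarrow> (nat \<Rightarrow> 'a) \<Rightarrow> nat \<Rightarrow> nat \<Rightarrow> real" where
  "chain_sum p xs i j = (\<Sum>k=i..<j. p (xs k) (xs (Suc k)))"

definition chain_metric :: "('a \<Rightarrow> 'a \<Rightarrow> real) \<Rightarrow> 'a \<Rightarrow> 'a \<Rightarrow> real" where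
  "chain_metric p x y = Inf {chain_sum p xs 0 n | xs n. xs 0 = x \<and> xs n = y}"

text \<open>Frink's argument: cut the chain at the link where half of its length is reached and apply the
  induction hypothesis to both pieces.\<close>

lemma chain_sum_ge:
  assumes p: "\<And>x y. 0 \<le> p x y" "\<And>x. p x x = 0"
    and quasi: "\<And>x y z w. p x w \<le> 2 * max (p x y) (max (p y z) (p z w))"
  shows "i \<le> j \<Longrightarrow> p (xs i) (xs j) \<le> 2 * chain_sum p xs i j"
proof (induction "j - i" arbitrary: i j rule: less_induct)
  case less
  let ?c = "chain_sum p xs"
  have nonneg: "0 \<le> ?c a b" for a b unfolding chain_sum_def by (intro sum_nonneg p)
  have add: "?c a b + ?c b d = ?c a d" if "a \<le> b" "b \<le> d" for a b d
    unfolding chain_sum_def using that by (rule sum.atLeastLessThan_concat)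
  show ?case
  proof (cases "i = j")
    case True
    then show ?thesis using nonneg[of i j] p(2) by simp
  next
    case False
    then have ij: "i < j" using less.prems by simp
    let ?P = "\<lambda>k. k < j \<and> i \<le> k \<and> ?c i k \<le> ?c i j / 2"
    have "?P i" using ij nonneg[of i j] by (simp add: chain_sum_def)
    then obtain k where "?P k" and max: "\<And>k'. ?P k' \<Longrightarrow> k' \<le> k"
      using ex_has_greatest_nat[of ?P i "\<lambda>k. k" j] by auto
    then have k: "k < j" "i \<le> k" "?c i k \<le> ?c i j / 2" by auto
    have tail: "?c (Suc k) j \<le> ?c i j / 2"
    proof (cases "Suc k = j")
      case True
      then show ?thesis using nonneg[of i j] by (simp add: chain_sum_def)
    next
      case False
      then have "\<not> ?c i (Suc k) \<le> ?c i j / 2" using max[of "Suc k"] k by auto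
      then show ?thesis using add[of i "Suc k" j] k by simp
    qed
    have link: "p (xs k) (xs (Suc k)) \<le> ?c i j"
    proof -
      have "?c i k + ?c k (Suc k) + ?c (Suc k) j = ?c i j"
        using add[of i k "Suc k"] add[of i "Suc k" j] k by simp
      moreover have "?c k (Suc k) = p (xs k) (xs (Suc k))" by (simp add: chain_sum_def)
      ultimately show ?thesis using nonneg[of i k] nonneg[of "Suc k" j] by simp
    qed
    have "p (xs i) (xs k) \<le> 2 * ?c i k" using k by (intro less.hyps) auto
    moreover have "p (xs (Suc k)) (xs j) \<le> 2 * ?c (Suc k) j" using k by (intro less.hyps) auto
    ultimately have "max (p (xs i) (xs k)) (max (p (xs k) (xs (Suc k))) (p (xs (Suc k)) (xs j))) \<le> ?c i j"
      using k(3) tail link by simp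
    then show ?thesis using quasi[of "xs i" "xs j" "xs k" "xs (Suc k)"] by linarith
  qed
qed

text \<open>Concatenating chains makes the triangle inequality automatic; by
  \<open>chain_sum_ge\<close> the infimum loses at most a factor 2 and so stays positive off the
  diagonal.\<close>

lemma chain_metric:
  assumes p: "\<And>x y. 0 \<le> p x y" "\<And>x y. p x y = 0 \<longleftrightarrow> x = y" "\<And>x y. p x y = p y x"
    and quasi: "\<And>x y z w. p x w \<le> 2 * max (p x y) (max (p y z) (p z w))"
  shows "is_metric (chain_metric p)" "chain_metric p x y \<le> p x y" "p x y \<le> 2 * chain_metric p x y"
proof -
  let ?S = "\<lambda>x y. {chain_sum p xs 0 n | xs n. xs 0 = x \<and> xs n = y}"
  have link: "p x y \<in> ?S x y" for x y
    by (intro CollectI exI[of _ "\<lambda>i. if i = 0 then x else y"] exI[of _ "1::nat"]) (simp add: chain_sum_def)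
  have nonneg: "0 \<le> a" if "a \<in> ?S x y" for a x y
    using that p(1) by (auto simp: chain_sum_def intro: sum_nonneg)
  then have bdd: "bdd_below (?S x y)" for x y by (meson bdd_belowI)
  show up: "chain_metric p x y \<le> p x y" for x y
    unfolding chain_metric_def by (rule cInf_lower[OF link bdd])
  show low: "p x y \<le> 2 * chain_metric p x y" for x y
  proof -
    have "p x y / 2 \<le> chain_metric p x y"
      unfolding chain_metric_def
    proof (rule cInf_greatest)
      show "?S x y \<noteq> {}" using link by blast
      fix a assume "a \<in> ?S x y"
      then obtain xs n where "a = chain_sum p xs 0 n" "xs 0 = x" "xs n = y" by blast
      then show "p x y / 2 \<le> a" using chain_sum_ge[of p 0 n xs] p(1,2) quasi by auto
    qed
    then show ?thesis by simp
  qed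
  have sym: "chain_metric p x y \<le> chain_metric p y x" for x y
  proof -
    have "?S y x \<subseteq> ?S x y"
    proof
      fix a assume "a \<in> ?S y x"
      then obtain xs n where a: "a = chain_sum p xs 0 n" "xs 0 = y" "xs n = x" by blast
      have "chain_sum p (\<lambda>i. xs (n - i)) 0 n = a"
        unfolding a(1) chain_sum_def
        by (rule sum.reindex_bij_witness[of _ "\<lambda>i. n - Suc i" "\<lambda>i. n - Suc i"])
          (auto simp: p(3) Suc_diff_Suc)
      then show "a \<in> ?S x y" using a by (intro CollectI exI[of _ "\<lambda>i. xs (n - i)"] exI[of _ n]) auto
    qed
    then show ?thesis unfolding chain_metric_def 
      by (intro cInf_superset_mono bdd) (use link[of y x] in blast)
  qed
  have near: "\<exists>xs n. chain_sum p xs 0 n < chain_metric p x y + e \<and> xs 0 = x \<and> xs n = y"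
    if "0 < e" for e x y
  proof -
    have "?S x y \<noteq> {}" using link[of x y] by blast
    then have "\<exists>a\<in>?S x y. a < chain_metric p x y + e"
      using that by (intro cInf_lessD) (auto simp: chain_metric_def)
    then show ?thesis by blast
  qed
  have tri: "chain_metric p x z \<le> chain_metric p x y + chain_metric p y z" for x y z
  proof (rule field_le_epsilon)
    fix e :: real assume "0 < e"
    obtain xs n where xs: "chain_sum p xs 0 n < chain_metric p x y + e / 2" "xs 0 = x" "xs n = y"
      using near[of "e / 2" x y] \<open>0 < e\<close> by auto
    obtain ys k where ys: "chain_sum p ys 0 k < chain_metric p y z + e / 2" "ys 0 = y" "ys k = z"
      using near[of "e / 2" y z] \<open>0 < e\<close> by auto
    define zs where "zs i = (if i < n then xs i else ys (i - n))" for i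
    have "chain_sum p zs 0 (n + k) = chain_sum p zs 0 n + chain_sum p zs n (n + k)"
      unfolding chain_sum_def by (rule sum.atLeastLessThan_concat[symmetric]) auto
    also have "chain_sum p zs 0 n = chain_sum p xs 0 n"
    proof -
      \<comment> \<open>At the junction i = n, \<open>zs\<close> already reads \<open>ys 0\<close>,
        which is y = \<open>xs n\<close>.\<close>
      have "zs i = xs i" if "i \<le> n" for i using that xs ys by (cases "i = n") (auto simp: zs_def)
      then show ?thesis unfolding chain_sum_def by (intro sum.cong) auto
    qed
    also have "chain_sum p zs n (n + k) = chain_sum p ys 0 k"
      unfolding chain_sum_def
      using sum.shift_bounds_nat_ivl[of "\<lambda>i. p (zs i) (zs (Suc i))" 0 n k]
      by (simp add: zs_def add.commute)
    finally have "chain_sum p zs 0 (n + k) = chain_sum p xs 0 n + chain_sum p ys 0 k" .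
    moreover have "chain_metric p x z \<le> chain_sum p zs 0 (n + k)"
      unfolding chain_metric_def
      by (intro cInf_lower bdd CollectI exI[of _ zs] exI[of _ "n + k"]) (use xs ys in \<open>auto simp: zs_def\<close>)
    ultimately show "chain_metric p x z \<le> chain_metric p x y + chain_metric p y z + e"
      using xs(1) ys(1) by simp
  qed
  have ge0: "0 \<le> chain_metric p x y" for x y using low[of x y] p(1)[of x y] by linarith
  moreover have "chain_metric p x y = 0 \<longleftrightarrow> x = y" for x y
    using low[of x y] up[of x y] ge0[of x y] p(1)[of x y] p(2)[of x y] by auto
  ultimately show "is_metric (chain_metric p)"
    unfolding is_metric_def using sym tri by (auto intro: antisym)
qed

subsection \<open>Energy and effective resistance\<close>

lemma ennreal_inverse_antimono:
  fixes a b :: ennreal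
  assumes "a \<le> b" shows "inverse b \<le> inverse a"
  using assms including ennreal.lifting by transfer (rule ereal_inverse_antimono)

locale conductance_graph =
  fixes E :: "'a \<Rightarrow> 'a \<Rightarrow> bool" and mu :: "'a \<Rightarrow> 'a \<Rightarrow> real"
  assumes simple: "simple_graph E"
    and connected: "connected_graph E"
    and locally_finite: "\<And>x. finite {y. E x y}"
    and conductance: "conductance E mu"
    and infinite_UNIV: "infinite (UNIV :: 'a set)"
begin

abbreviation nb :: "'a \<Rightarrow> 'a set" where "nb x \<equiv> {y. E x y}"
abbreviation m :: "'a \<Rightarrow> real" where "m \<equiv> mu_v E mu"
abbreviation R :: "'a \<Rightarrow> 'a \<Rightarrow> real" where "R \<equiv> res_metric E mu"

lemma E_sym: "E x y \<Longrightarrow> E y x"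
  using simple by (auto simp: simple_graph_def)

lemma nb_sym: "{y. E y x} = nb x"
  using E_sym by blast

lemma E_neq: "E x y \<Longrightarrow> x \<noteq> y"
  using simple by (auto simp: simple_graph_def)

lemma mu_pos: "E x y \<Longrightarrow> 0 < mu x y"
  using conductance by (auto simp: conductance_def)

lemma mu_sym: "E x y \<Longrightarrow> mu x y = mu y x"
  using conductance by (auto simp: conductance_def)

lemma ex_nb: "\<exists>y. E x y"
proof -
  obtain z where "z \<noteq> x" using infinite_UNIV by (metis finite.emptyI finite_insert UNIV_eq_I insertI1)
  moreover have "E\<^sup>*\<^sup>* x z" using connected by (auto simp: connected_graph_def)
  ultimately show ?thesis by (metis converse_rtranclpE)
qed

lemma m_pos: "0 < m x"
  unfolding mu_v_def using ex_nb[of x] by (intro sum_pos) (auto simp: locally_finite mu_pos)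

lemma mu_le_m: "E x y \<Longrightarrow> mu x y \<le> m x"
  unfolding mu_v_def using member_le_sum[of y "nb x" "mu x"]
  by (simp add: locally_finite less_imp_le mu_pos)

text \<open>The energy depends only on squared increments along edges, so an edgewise bound can be
  integrated. One function gives rescaling, several give the product cutoffs.\<close>

lemma energy_le_sum:
  assumes "finite I" "\<And>i. i \<in> I \<Longrightarrow> 0 \<le> c i"
    and le: "\<And>x y. E x y \<Longrightarrow> (g x - g y)\<^sup>2 \<le> (\<Sum>i\<in>I. c i * (f i x - f i y)\<^sup>2)"
  shows "energy E mu g \<le> (\<Sum>i\<in>I. ennreal (c i) * energy E mu (f i))"
proof -
  let ?S = "{(x,y). E x y}"
  let ?t = "\<lambda>h p. (h (fst p) - h (snd p))\<^sup>2 * mu (fst p) (snd p)"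
  have "(\<integral>\<^sup>+ p. ennreal (?t g p) \<partial>count_space ?S)
      \<le> (\<integral>\<^sup>+ p. (\<Sum>i\<in>I. ennreal (c i) * ennreal (?t (f i) p)) \<partial>count_space ?S)"
  proof (rule nn_integral_mono)
    fix p assume "p \<in> space (count_space ?S)"
    then obtain x y where p: "p = (x,y)" "E x y" by auto
    have "?t g p \<le> (\<Sum>i\<in>I. c i * (f i x - f i y)\<^sup>2) * mu x y"
      using le[OF p(2)] mu_pos[OF p(2)] p(1) by (simp add: mult_right_mono)
    also have "\<dots> = (\<Sum>i\<in>I. c i * ?t (f i) p)"
      using p(1) by (simp add: sum_distrib_right mult.assoc)
    finally have "ennreal (?t g p) \<le> ennreal (\<Sum>i\<in>I. c i * ?t (f i) p)"
      by (rule ennreal_leI)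
    also have "\<dots> = (\<Sum>i\<in>I. ennreal (c i * ?t (f i) p))"
      using assms(2) mu_pos[OF p(2)] p(1) by (intro sum_ennreal[symmetric]) auto
    also have "\<dots> = (\<Sum>i\<in>I. ennreal (c i) * ennreal (?t (f i) p))"
      using assms(2) mu_pos[OF p(2)] p(1) by (intro sum.cong refl ennreal_mult) auto
    finally show "ennreal (?t g p) \<le> (\<Sum>i\<in>I. ennreal (c i) * ennreal (?t (f i) p))" .
  qed
  also have "\<dots> = (\<Sum>i\<in>I. ennreal (c i) * (\<integral>\<^sup>+ p. ennreal (?t (f i) p) \<partial>count_space ?S))"
    by (subst nn_integral_sum) (auto simp: nn_integral_cmult)
  finally have "energy E mu g
      \<le> ennreal (1/2) * (\<Sum>i\<in>I. ennreal (c i) * (\<integral>\<^sup>+ p. ennreal (?t (f i) p) \<partial>count_space ?S))"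
    unfolding energy_def by (rule mult_left_mono) simp
  also have "\<dots> = (\<Sum>i\<in>I. ennreal (c i) * energy E mu (f i))"
    unfolding energy_def sum_distrib_left by (intro sum.cong refl mult.left_commute)
  finally show ?thesis .
qed

lemma energy_affine: "energy E mu (\<lambda>x. a * f x + b) \<le> ennreal (a\<^sup>2) * energy E mu f"
  using energy_le_sum[of "{()}" "\<lambda>_. a\<^sup>2" "\<lambda>x. a * f x + b" "\<lambda>_. f"]
  by (simp add: power_mult_distrib flip: right_diff_distrib)

text \<open>Only one of the two orientations of the edge is kept, hence the half.\<close>

lemma energy_edge:
  assumes "E x y" shows "ennreal ((f x - f y)\<^sup>2 * mu x y / 2) \<le> energy E mu f"
proof -
  have "ennreal ((f x - f y)\<^sup>2 * mu x y)
      \<le> (\<integral>\<^sup>+ p. ennreal ((f (fst p) - f (snd p))^2 * mu (fst p) (snd p)) \<partial>count_space {(x,y). E x y})"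
    using nn_integral_ge_point[of "(x,y)" "{(x,y). E x y}"
        "\<lambda>p. ennreal ((f (fst p) - f (snd p))^2 * mu (fst p) (snd p))"] assms by simp
  then have "ennreal (1/2) * ennreal ((f x - f y)\<^sup>2 * mu x y) \<le> energy E mu f"
    unfolding energy_def by (rule mult_left_mono) simp
  moreover have "ennreal (1/2) * ennreal ((f x - f y)\<^sup>2 * mu x y) = ennreal ((f x - f y)\<^sup>2 * mu x y / 2)"
    using mu_pos[OF assms] by (subst ennreal_mult[symmetric]) auto
  ultimately show ?thesis by simp
qed

subsection \<open>The resistance as an optimal constant\<close>

text \<open>Induction along a path: each edge controls its own increment, and (a + b)^2 <= 2 a^2 + 2
  b^2 joins them.\<close>

lemma ex_osc_bound:
  "\<exists>c\<ge>0. \<forall>f e. 0 \<le> e \<longrightarrow> energy E mu f \<le> ennreal e \<longrightarrow> (f x - f y)\<^sup>2 \<le> c * e"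
proof -
  have "E\<^sup>*\<^sup>* x y" using connected by (auto simp: connected_graph_def)
  then show ?thesis
  proof (induction rule: rtranclp_induct)
    case base
    show ?case by (intro exI[of _ 0]) auto
  next
    case (step y z)
    then obtain c where c: "c \<ge> 0"
      "\<And>f e. 0 \<le> e \<Longrightarrow> energy E mu f \<le> ennreal e \<Longrightarrow> (f x - f y)\<^sup>2 \<le> c * e" by blast
    have "(f x - f z)\<^sup>2 \<le> (2 * c + 4 / mu y z) * e" if e: "0 \<le> e" "energy E mu f \<le> ennreal e" for f e
    proof -
      have "ennreal ((f y - f z)\<^sup>2 * mu y z / 2) \<le> ennreal e"
        using energy_edge[OF step(2)] e(2) by (rule order_trans)
      then have "(f y - f z)\<^sup>2 * mu y z / 2 \<le> e" using e(1) by (simp add: ennreal_le_iff)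
      then have "(f y - f z)\<^sup>2 \<le> 2 / mu y z * e" using mu_pos[OF step(2)] by (simp add: field_simps)
      moreover have "(f x - f z)\<^sup>2 \<le> 2 * (f x - f y)\<^sup>2 + 2 * (f y - f z)\<^sup>2"
        using zero_le_power2[of "(f x - f y) - (f y - f z)"] by (simp add: power2_eq_square algebra_simps)
      ultimately have "(f x - f z)\<^sup>2 \<le> 2 * (c * e) + 2 * (2 / mu y z * e)"
        using c(2)[OF e] by linarith
      then show ?thesis by (simp add: algebra_simps)
    qed
    moreover have "0 \<le> 2 * c + 4 / mu y z" using c(1) mu_pos[OF step(2)] by simp
    ultimately show ?case by blast
  qed
qed

lemma Inf_energy_ge:
  assumes "0 < c" "\<And>f e. 0 \<le> e \<Longrightarrow> energy E mu f \<le> ennreal e \<Longrightarrow> (f x - f y)\<^sup>2 \<le> c * e"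
  shows "ennreal (1 / c) \<le> Inf {energy E mu f | f. (\<forall>z\<in>{x}. f z = 1) \<and> (\<forall>z\<in>{y}. f z = 0)}"
proof (rule Inf_greatest)
  fix b assume "b \<in> {energy E mu f | f. (\<forall>z\<in>{x}. f z = 1) \<and> (\<forall>z\<in>{y}. f z = 0)}"
  then obtain f where f: "b = energy E mu f" "f x = 1" "f y = 0" by auto
  show "ennreal (1 / c) \<le> b"
  proof (cases b)
    case (real e)
    then have "1 \<le> c * e" using assms(2)[of e f] f by simp
    then show ?thesis using real assms(1) by (auto intro!: ennreal_leI simp: field_simps)
  qed simp
qed

lemma eff_res_points_le:
  assumes "0 < c" "\<And>f e. 0 \<le> e \<Longrightarrow> energy E mu f \<le> ennreal e \<Longrightarrow> (f x - f y)\<^sup>2 \<le> c * e"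
  shows "eff_res E mu {x} {y} \<le> ennreal c"
proof -
  have "eff_res E mu {x} {y} \<le> inverse (ennreal (1 / c))"
    unfolding eff_res_def using Inf_energy_ge[OF assms] by (rule ennreal_inverse_antimono)
  also have "\<dots> = ennreal c" using assms(1) by (subst inverse_ennreal) auto
  finally show ?thesis .
qed

text \<open>Connectedness makes the resistance between points finite, so \<open>enn2real\<close> in
  \<open>R\<close> does not send an infinite value to 0.\<close>

lemma eff_res_points: "eff_res E mu {x} {y} = ennreal (R x y)"
proof -
  obtain c where "0 \<le> c"
    "\<And>f e. 0 \<le> e \<Longrightarrow> energy E mu f \<le> ennreal e \<Longrightarrow> (f x - f y)\<^sup>2 \<le> c * e"
    using ex_osc_bound by blast
  \<comment> \<open>The constant \<open>c\<close> may be 0, whereas \<open>eff_res_points_le\<close>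
    asks for a positive one.\<close>
  moreover from this have "(f x - f y)\<^sup>2 \<le> (c + 1) * e"
    if "0 \<le> e" "energy E mu f \<le> ennreal e" for f e
    by (smt (verit) mult_right_mono that)
  ultimately have "eff_res E mu {x} {y} \<le> ennreal (c + 1)"
    by (intro eff_res_points_le) auto
  then have "eff_res E mu {x} {y} < top" by (rule le_less_trans) simp
  then show ?thesis unfolding res_metric_def by simp
qed

lemma R_nonneg: "0 \<le> R x y"
  unfolding res_metric_def by simp

text \<open>With \<open>osc_le\<close> this makes \<open>R x y\<close> the least constant in the
  oscillation inequality; symmetry and the quasi-triangle inequality are read off from that.\<close>

lemma R_le:
  assumes "0 \<le> c" "\<And>f e. 0 \<le> e \<Longrightarrow> energy E mu f \<le> ennreal e \<Longrightarrow> (f x - f y)\<^sup>2 \<le> c * e"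
  shows "R x y \<le> c"
proof (rule field_le_epsilon)
  fix \<epsilon> :: real assume "0 < \<epsilon>"
  have "(f x - f y)\<^sup>2 \<le> (c + \<epsilon>) * e"
    if "0 \<le> e" "energy E mu f \<le> ennreal e" for f e
    using assms(2)[OF that] \<open>0 < \<epsilon>\<close> that(1) by (smt (verit) mult_right_mono)
  then have "eff_res E mu {x} {y} \<le> ennreal (c + \<epsilon>)"
    using \<open>0 < \<epsilon>\<close> assms(1) by (intro eff_res_points_le) auto
  then show "R x y \<le> c + \<epsilon>"
    using \<open>0 < \<epsilon>\<close> assms(1) by (simp add: eff_res_points ennreal_le_iff del: ennreal_plus)
qed

text \<open>An affine change makes \<open>f\<close> equal to 1 at x and 0 at y, hence a competitor
  in the infimum defining the resistance.\<close>

lemma osc_le: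
  assumes "0 \<le> e" "energy E mu f \<le> ennreal e"
  shows "(f x - f y)\<^sup>2 \<le> R x y * e"
proof (cases "f x = f y")
  case True
  then show ?thesis using assms(1) R_nonneg by simp
next
  case False
  define a where "a = 1 / (f x - f y)"
  let ?g = "\<lambda>z. a * f z + (- a * f y)"
  let ?I = "Inf {energy E mu f | f. (\<forall>z\<in>{x}. f z = 1) \<and> (\<forall>z\<in>{y}. f z = 0)}"
  have "a * f x - a * f y = 1" using False by (simp add: a_def flip: diff_divide_distrib)
  then have "?I \<le> energy E mu ?g" by (intro Inf_lower) force
  also have "\<dots> \<le> ennreal (a\<^sup>2) * energy E mu f" by (rule energy_affine)
  also have "\<dots> \<le> ennreal (a\<^sup>2) * ennreal e" using assms(2) by (rule mult_left_mono) simp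
  also have "\<dots> = ennreal (a\<^sup>2 * e)" using assms(1) by (simp add: ennreal_mult)
  finally have I: "?I \<le> ennreal (a\<^sup>2 * e)" .
  have "inverse (ennreal (a\<^sup>2 * e)) \<le> ennreal (R x y)"
    unfolding eff_res_points[symmetric] eff_res_def by (rule ennreal_inverse_antimono[OF I])
  \<comment> \<open>A zero product would have inverse \<open>top\<close>, against the finite bound
    \<open>R x y\<close>.\<close>
  moreover from this have "a\<^sup>2 * e \<noteq> 0" by (metis ennreal_0 ennreal_inverse_zero ennreal_top_eq_mult_iff
        ennreal_neq_top neq_top_trans)
  ultimately have "ennreal (inverse (a\<^sup>2 * e)) \<le> ennreal (R x y)"
    using assms(1) by (subst inverse_ennreal[symmetric]) (auto simp: less_le)
  then have "inverse (a\<^sup>2 * e) \<le> R x y" using R_nonneg by (simp add: ennreal_le_iff)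
  then have "1 \<le> R x y * (a\<^sup>2 * e)" using \<open>a\<^sup>2 * e \<noteq> 0\<close> assms(1)
    by (simp add: field_simps less_le)
  then show ?thesis using False by (simp add: a_def power_divide field_simps)
qed

lemma R_refl [simp]: "R x x = 0"
  using R_le[of 0 x x] R_nonneg[of x x] by simp

lemma R_sym: "R x y = R y x"
proof (rule antisym)
  show "R x y \<le> R y x" for x y
    using osc_le[of _ _ y x] by (intro R_le R_nonneg) (simp add: power2_commute)
  then show "R y x \<le> R x y" .
qed

text \<open>The factor 2 comes from (a + b)^2 <= 2 a^2 + 2 b^2; the later metrization absorbs
  it.\<close>

lemma R_quasi_triangle: "R x z \<le> 2 * (R x y + R y z)"
proof (rule R_le)
  show "0 \<le> 2 * (R x y + R y z)" using R_nonneg by simp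
  fix f e assume e: "0 \<le> e" "energy E mu f \<le> ennreal e"
  have "(f x - f z)\<^sup>2 \<le> 2 * (f x - f y)\<^sup>2 + 2 * (f y - f z)\<^sup>2"
    using zero_le_power2[of "(f x - f y) - (f y - f z)"] by (simp add: power2_eq_square algebra_simps)
  then show "(f x - f z)\<^sup>2 \<le> 2 * (R x y + R y z) * e"
    using osc_le[OF e, of x y] osc_le[OF e, of y z] by (simp add: algebra_simps)
qed

lemma R_edge_le: "E x y \<Longrightarrow> R x y \<le> 2 / mu x y"
proof (rule R_le)
  assume xy: "E x y"
  show "0 \<le> 2 / mu x y" using mu_pos[OF xy] by simp
  fix f e assume e: "0 \<le> e" "energy E mu f \<le> ennreal e"
  have "ennreal ((f x - f y)\<^sup>2 * mu x y / 2) \<le> ennreal e"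
    using energy_edge[OF xy] e(2) by (rule order_trans)
  then have "(f x - f y)\<^sup>2 * mu x y / 2 \<le> e" using e(1) by (simp add: ennreal_le_iff)
  then show "(f x - f y)\<^sup>2 \<le> 2 / mu x y * e" using mu_pos[OF xy] by (simp add: field_simps)
qed

lemma eff_res_ge:
  assumes "0 < e" "energy E mu f \<le> ennreal e" "\<And>x. x \<in> A \<Longrightarrow> f x = 1" "\<And>x. x \<in> B \<Longrightarrow> f x = 0"
  shows "ennreal (1 / e) \<le> eff_res E mu A B"
proof -
  have "Inf {energy E mu f | f. (\<forall>x\<in>A. f x = 1) \<and> (\<forall>x\<in>B. f x = 0)} \<le> energy E mu f"
    using assms(3,4) by (intro Inf_lower) auto
  then have "Inf {energy E mu f | f. (\<forall>x\<in>A. f x = 1) \<and> (\<forall>x\<in>B. f x = 0)} \<le> ennreal e"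
    using assms(2) by (rule order_trans)
  then have "inverse (ennreal e) \<le> eff_res E mu A B"
    unfolding eff_res_def by (rule ennreal_inverse_antimono)
  then show ?thesis using assms(1) by (simp add: inverse_ennreal inverse_eq_divide)
qed

lemma eff_res_antimono:
  assumes "A \<subseteq> A'" "B \<subseteq> B'" shows "eff_res E mu A' B' \<le> eff_res E mu A B"
  unfolding eff_res_def using assms by (intro ennreal_inverse_antimono Inf_superset_mono) blast

text \<open>The infimum is at most 1 / r; the factor 2 leaves room to pick a function without
  attaining it.\<close>

lemma ex_near_minimizer:
  assumes "0 < r" "r \<le> R x y"
  shows "\<exists>f. f x = 1 \<and> f y = 0 \<and> energy E mu f \<le> ennreal (2 / r)"
proof (rule ccontr)
  assume *: "\<not> ?thesis"
  have "ennreal (2 / r) \<le> Inf {energy E mu f | f. (\<forall>z\<in>{x}. f z = 1) \<and> (\<forall>z\<in>{y}. f z = 0)}"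
    using * by (intro Inf_greatest) (auto simp: not_le intro: less_imp_le)
  then have "eff_res E mu {x} {y} \<le> inverse (ennreal (2 / r))"
    unfolding eff_res_def by (rule ennreal_inverse_antimono)
  also have "\<dots> = ennreal (r / 2)" using assms(1) by (simp add: inverse_ennreal)
  finally show False using assms by (simp add: eff_res_points ennreal_le_iff)
qed

subsection \<open>Summation by parts\<close>

definition lap :: "('a \<Rightarrow> real) \<Rightarrow> 'a \<Rightarrow> real" where
  "lap g x = (\<Sum>y\<in>nb x. mu x y * (g x - g y))"

definition edges_at :: "'a set \<Rightarrow> ('a \<times> 'a) set" where
  "edges_at S = {(x,y). E x y \<and> (x \<in> S \<or> y \<in> S)}"

lemma edges_at_eq: "edges_at S = Sigma S nb \<union> prod.swap ` Sigma S nb"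
  unfolding edges_at_def using E_sym by (force simp: image_iff)

lemma finite_edges_at: "finite S \<Longrightarrow> finite (edges_at S)"
  unfolding edges_at_eq by (auto simp: locally_finite)

text \<open>For finite S a finite real sum; it is the full Dirichlet form as soon as one argument
  vanishes off S.\<close>

definition dform :: "'a set \<Rightarrow> ('a \<Rightarrow> real) \<Rightarrow> ('a \<Rightarrow> real) \<Rightarrow> real" where
  "dform S f g = (\<Sum>(x,y)\<in>edges_at S. (f x - f y) * (g x - g y) * mu x y) / 2"

text \<open>\<open>edges_at\<close> holds both orientations of every edge; exchanging them turns the
  \<open>f y\<close> half into the \<open>f x\<close> half, which cancels the division by 2.\<close>

lemma dform_eq_lap:
  assumes "finite S" "\<And>x. x \<notin> S \<Longrightarrow> f x = 0"
  shows "dform S f g = (\<Sum>x\<in>S. f x * lap g x)"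
proof -
  let ?F = "edges_at S"
  have swap: "(\<Sum>(x,y)\<in>?F. f y * (g x - g y) * mu x y) = - (\<Sum>(x,y)\<in>?F. f x * (g x - g y) * mu x y)"
  proof -
    have "(\<Sum>(x,y)\<in>?F. f y * (g x - g y) * mu x y) = (\<Sum>(x,y)\<in>?F. f x * (g y - g x) * mu x y)"
      by (rule sum.reindex_bij_witness[of _ prod.swap prod.swap])
        (auto simp: edges_at_def E_sym mu_sym)
    also have "\<dots> = (\<Sum>(x,y)\<in>?F. - (f x * (g x - g y) * mu x y))"
      by (rule sum.cong) (auto simp: algebra_simps)
    also have "\<dots> = - (\<Sum>(x,y)\<in>?F. f x * (g x - g y) * mu x y)"
      by (simp add: case_prod_unfold sum_negf)
    finally show ?thesis .
  qed
  have "(\<Sum>(x,y)\<in>?F. (f x - f y) * (g x - g y) * mu x y)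
      = (\<Sum>(x,y)\<in>?F. f x * (g x - g y) * mu x y) - (\<Sum>(x,y)\<in>?F. f y * (g x - g y) * mu x y)"
    unfolding sum_subtractf[symmetric] by (rule sum.cong) (auto simp: algebra_simps)
  then have "dform S f g = (\<Sum>(x,y)\<in>?F. f x * (g x - g y) * mu x y)"
    unfolding dform_def swap by simp
  also have "\<dots> = (\<Sum>(x,y)\<in>Sigma S nb. f x * (g x - g y) * mu x y)"
    using finite_edges_at[OF assms(1)] assms(2)
    by (intro sum.mono_neutral_right) (force simp: edges_at_def)+
  also have "\<dots> = (\<Sum>x\<in>S. \<Sum>y\<in>nb x. f x * (g x - g y) * mu x y)"
    using assms(1) locally_finite by (subst sum.Sigma) auto
  also have "\<dots> = (\<Sum>x\<in>S. f x * lap g x)"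
    unfolding lap_def sum_distrib_left by (intro sum.cong refl) (auto simp: algebra_simps)
  finally show ?thesis .
qed

lemma energy_eq_dform:
  assumes "finite S" "\<And>x. x \<notin> S \<Longrightarrow> f x = 0"
  shows "energy E mu f = ennreal (dform S f f)"
proof -
  let ?t = "\<lambda>p. (f (fst p) - f (snd p))^2 * mu (fst p) (snd p)"
  have "(\<integral>\<^sup>+ p. ennreal (?t p) \<partial>count_space {(x,y). E x y}) = (\<Sum>p\<in>edges_at S. ennreal (?t p))"
    using finite_edges_at[OF assms(1)] assms(2)
    by (intro nn_integral_count_space') (force simp: edges_at_def)+
  also have "\<dots> = ennreal (\<Sum>p\<in>edges_at S. ?t p)"
    by (intro sum_ennreal) (auto simp: edges_at_def mu_pos less_imp_le)
  finally have "energy E mu f = ennreal (1/2) * ennreal (\<Sum>p\<in>edges_at S. ?t p)"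
    unfolding energy_def by simp
  also have "\<dots> = ennreal (1/2 * (\<Sum>p\<in>edges_at S. ?t p))"
    by (intro ennreal_mult[symmetric] sum_nonneg) (auto simp: edges_at_def mu_pos less_imp_le)
  finally show ?thesis
    unfolding dform_def by (simp add: case_prod_unfold power2_eq_square)
qed

lemma dform_nonneg: "0 \<le> dform S f f"
  unfolding dform_def by (intro divide_nonneg_pos sum_nonneg) (auto simp: edges_at_def mu_pos less_imp_le)

lemma dform_Cauchy_Schwarz: "(dform S f g)\<^sup>2 \<le> dform S f f * dform S g g"
proof -
  let ?a = "\<lambda>h p. (h (fst p) - h (snd p)) * sqrt (mu (fst p) (snd p))"
  have eq: "dform S h k = (\<Sum>p\<in>edges_at S. ?a h p * ?a k p) / 2" for h k
    unfolding dform_def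
    by (auto simp: edges_at_def case_prod_unfold mu_pos less_imp_le intro!: sum.cong)
  have "(\<Sum>p\<in>edges_at S. ?a f p * ?a g p)\<^sup>2
      \<le> (\<Sum>p\<in>edges_at S. (?a f p)\<^sup>2) * (\<Sum>p\<in>edges_at S. (?a g p)\<^sup>2)"
    by (rule Cauchy_Schwarz_ineq_sum)
  then show ?thesis unfolding eq by (simp add: power2_eq_square field_simps)
qed

lemma energy_indicator: "energy E mu (\<lambda>z. if z = x then 1 else 0) = ennreal (m x)"
proof -
  have "dform {x} (\<lambda>z. if z = x then 1 else 0) (\<lambda>z. if z = x then 1 else 0) = m x"
    by (subst dform_eq_lap) (auto simp: lap_def mu_v_def dest: E_neq intro!: sum.cong)
  then show ?thesis by (subst energy_eq_dform[of "{x}"]) auto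
qed

text \<open>The indicator of x is a test function of energy \<open>m x\<close>.\<close>

lemma R_ge: "x \<noteq> y \<Longrightarrow> 1 / m x \<le> R x y"
  using osc_le[of "m x" "\<lambda>z. if z = x then 1 else 0" x y] m_pos[of x]
  by (simp add: energy_indicator field_simps less_imp_le)

lemma R_pos: "x \<noteq> y \<Longrightarrow> 0 < R x y"
  using R_ge[of x y] m_pos[of x] by (smt (verit) divide_pos_pos)

subsection \<open>The heat kernel\<close>

definition avg :: "('a \<Rightarrow> real) \<Rightarrow> 'a \<Rightarrow> real" where
  "avg f x = (\<Sum>y\<in>nb x. mu x y * f y) / m x"

lemma m_avg: "m x * avg f x = (\<Sum>y\<in>nb x. mu x y * f y)"
  using m_pos[of x] by (simp add: avg_def)

lemma lap_eq_avg: "lap g x = m x * (g x - avg g x)"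
  unfolding right_diff_distrib m_avg
  by (simp add: lap_def right_diff_distrib sum_subtractf mu_v_def sum_distrib_right)

lemma hk_0: "hk E mu 0 x z = (if x = z then 1 / m x else 0)"
  by (simp add: hk_def)

text \<open>Symmetry of \<open>mu\<close> turns the last step of the walk into averaging over the
  neighbours of the end point.\<close>

lemma hk_Suc: "hk E mu (Suc n) x z = avg (hk E mu n x) z"
  unfolding hk_def avg_def pn.simps nb_sym
  by (auto simp: trans_prob_def E_sym mu_sym intro!: arg_cong2[of _ _ _ _ "(/)"] sum.cong)

lemma hk_nonneg: "0 \<le> hk E mu n x z"
proof (induction n arbitrary: z)
  case 0
  show ?case using m_pos[of x] by (auto simp: hk_0)
next
  case (Suc n)
  then show ?case using m_pos[of z]
    by (auto simp: hk_Suc avg_def mu_pos less_imp_le intro!: divide_nonneg_nonneg sum_nonneg)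
qed

text \<open>The walk reaches finitely many vertices in finitely many steps; one finite set for all
  times up to n reduces later sums to finite ones.\<close>

lemma ex_hk_support: "\<exists>S. finite S \<and> (\<forall>k\<le>n. \<forall>z. z \<notin> S \<longrightarrow> hk E mu k x z = 0)"
proof (induction n)
  case 0
  show ?case by (intro exI[of _ "{x}"]) (auto simp: hk_0)
next
  case (Suc n)
  then obtain S where S: "finite S" "\<And>k z. k \<le> n \<Longrightarrow> z \<notin> S \<Longrightarrow> hk E mu k x z = 0" by blast
  have "hk E mu (Suc n) x z = 0" if "z \<notin> (\<Union>y\<in>S. nb y)" for z
  proof -
    have "hk E mu n x y = 0" if "E z y" for y
      using S(2)[of n y] that \<open>z \<notin> _\<close> E_sym[of z y] by blast
    then show ?thesis unfolding hk_Suc avg_def by simp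
  qed
  then show ?case using S locally_finite
    by (intro exI[of _ "S \<union> (\<Union>y\<in>S. nb y)"]) (auto simp: le_Suc_eq)
qed

text \<open>\<open>mu\<close> is unspecified off the edges; extension by 0 gives a symmetric kernel,
  so double sums over vertices can be exchanged.\<close>

abbreviation wt :: "'a \<Rightarrow> 'a \<Rightarrow> real" where
  "wt x y \<equiv> (if E x y then mu x y else 0)"

lemma wt_sym: "wt x y = wt y x"
  using E_sym mu_sym by auto

lemma m_avg_support:
  assumes "finite S" "\<And>y. y \<notin> S \<Longrightarrow> f y = 0"
  shows "m x * avg f x = (\<Sum>y\<in>S. wt x y * f y)"
proof -
  have "(\<Sum>y\<in>nb x. mu x y * f y) = (\<Sum>y\<in>nb x \<inter> S. mu x y * f y)"
    using assms locally_finite by (intro sum.mono_neutral_right) auto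
  also have "\<dots> = (\<Sum>y\<in>nb x \<inter> S. wt x y * f y)"
    by (rule sum.cong) auto
  also have "\<dots> = (\<Sum>y\<in>S. wt x y * f y)"
    using assms by (intro sum.mono_neutral_left) auto
  finally show ?thesis unfolding m_avg .
qed

lemma sum_wt_le: "finite S \<Longrightarrow> (\<Sum>z\<in>S. wt z y) \<le> m y"
proof -
  assume "finite S"
  then have "(\<Sum>z\<in>S. wt z y) = (\<Sum>z\<in>S \<inter> nb y. mu y z)"
    using E_sym mu_sym by (intro sum.mono_neutral_cong_right) auto
  also have "\<dots> \<le> m y"
    unfolding mu_v_def using mu_pos by (intro sum_mono2 locally_finite) (auto simp: less_imp_le)
  finally show ?thesis .
qed

lemma avg_selfadjoint:
  assumes "finite S" "\<And>y. y \<notin> S \<Longrightarrow> f y = 0" "\<And>y. y \<notin> S \<Longrightarrow> g y = 0"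
  shows "(\<Sum>z\<in>S. avg f z * g z * m z) = (\<Sum>z\<in>S. f z * avg g z * m z)"
proof -
  have "(\<Sum>z\<in>S. avg f z * g z * m z) = (\<Sum>z\<in>S. g z * (m z * avg f z))"
    by (simp add: mult_ac)
  also have "\<dots> = (\<Sum>z\<in>S. \<Sum>y\<in>S. g z * (wt z y * f y))"
    by (intro sum.cong refl) (simp add: m_avg_support[of S f, OF assms(1,2)] sum_distrib_left)
  also have "\<dots> = (\<Sum>y\<in>S. \<Sum>z\<in>S. g z * (wt z y * f y))"
    by (rule sum.swap)
  also have "\<dots> = (\<Sum>y\<in>S. \<Sum>z\<in>S. f y * (wt y z * g z))"
    by (intro sum.cong refl) (simp add: wt_sym)
  also have "\<dots> = (\<Sum>y\<in>S. f y * (m y * avg g y))"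
    by (intro sum.cong refl) (simp add: m_avg_support[of S g, OF assms(1,3)] sum_distrib_left)
  also have "\<dots> = (\<Sum>z\<in>S. f z * avg g z * m z)"
    by (simp add: mult_ac)
  finally show ?thesis .
qed

text \<open>After exchanging the sums, y hands \<open>wt z y * f y\<close> to each z, in total at
  most \<open>m y * f y\<close>. Applied to the kernel and to its square.\<close>

lemma sum_avg_le:
  assumes "finite S" "finite T" "\<And>y. y \<notin> S \<Longrightarrow> f y = 0" "\<And>y. 0 \<le> f y"
  shows "(\<Sum>z\<in>T. avg f z * m z) \<le> (\<Sum>y\<in>S. f y * m y)"
proof -
  have "(\<Sum>z\<in>T. avg f z * m z) = (\<Sum>z\<in>T. \<Sum>y\<in>S. wt z y * f y)"
    by (intro sum.cong refl) (simp add: mult.commute[of "avg f _"] m_avg_support[of S f, OF assms(1,3)])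
  also have "\<dots> = (\<Sum>y\<in>S. (\<Sum>z\<in>T. wt z y) * f y)"
    unfolding sum_distrib_right by (rule sum.swap)
  also have "\<dots> \<le> (\<Sum>y\<in>S. m y * f y)"
    by (intro sum_mono mult_right_mono sum_wt_le assms)
  finally show ?thesis by (simp add: mult.commute)
qed

lemma hk_mass: "finite T \<Longrightarrow> (\<Sum>z\<in>T. hk E mu k x z * m z) \<le> 1"
proof (induction k arbitrary: T)
  case 0
  have "(\<Sum>z\<in>T. hk E mu 0 x z * m z) = (\<Sum>z\<in>T. if x = z then 1 else 0)"
    using m_pos[of x] by (intro sum.cong) (auto simp: hk_0)
  then show ?case using 0 by simp
next
  case (Suc k)
  obtain S where S: "finite S" "\<And>z. z \<notin> S \<Longrightarrow> hk E mu k x z = 0"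
    using ex_hk_support[of k x] by blast
  have "(\<Sum>z\<in>T. hk E mu (Suc k) x z * m z) \<le> (\<Sum>z\<in>S. hk E mu k x z * m z)"
    unfolding hk_Suc using S Suc.prems hk_nonneg by (intro sum_avg_le) auto
  also have "\<dots> \<le> 1" by (rule Suc.IH[OF S(1)])
  finally show ?case .
qed

text \<open>Self-adjointness moves one averaging step at a time from the first factor to the second,
  until the first is the normalised point mass at x.\<close>

lemma hk_semigroup:
  assumes "finite S" "\<And>k z. k \<le> i + j \<Longrightarrow> z \<notin> S \<Longrightarrow> hk E mu k x z = 0"
  shows "hk E mu (i + j) x x = (\<Sum>z\<in>S. hk E mu i x z * hk E mu j x z * m z)"
  using assms(2)
proof (induction i arbitrary: j)
  case 0
  have "x \<in> S" using 0[of 0 x] m_pos[of x] by (auto simp: hk_0)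
  have "(\<Sum>z\<in>S. hk E mu 0 x z * hk E mu j x z * m z) = (\<Sum>z\<in>S. if x = z then hk E mu j x z else 0)"
    using m_pos[of x] by (intro sum.cong) (auto simp: hk_0)
  then show ?case using \<open>x \<in> S\<close> assms(1) by simp
next
  case (Suc i)
  have "(\<Sum>z\<in>S. hk E mu (Suc i) x z * hk E mu j x z * m z)
      = (\<Sum>z\<in>S. hk E mu i x z * hk E mu (Suc j) x z * m z)"
    unfolding hk_Suc using Suc.prems by (intro avg_selfadjoint assms(1)) auto
  also have "\<dots> = hk E mu (i + Suc j) x x"
    using Suc.prems by (intro Suc.IH[symmetric]) auto
  finally show ?case by simp
qed

lemma avg_square_le: "(avg f z)\<^sup>2 \<le> avg (\<lambda>y. (f y)\<^sup>2) z"
proof -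
  have "(\<Sum>y\<in>nb z. mu z y * f y)\<^sup>2 = (\<Sum>y\<in>nb z. sqrt (mu z y) * (sqrt (mu z y) * f y))\<^sup>2"
    by (intro arg_cong[of _ _ "\<lambda>a. a\<^sup>2"] sum.cong) (auto simp: mu_pos less_imp_le simp flip: mult.assoc)
  also have "\<dots> \<le> (\<Sum>y\<in>nb z. (sqrt (mu z y))\<^sup>2) * (\<Sum>y\<in>nb z. (sqrt (mu z y) * f y)\<^sup>2)"
    by (rule Cauchy_Schwarz_ineq_sum)
  also have "\<dots> = m z * (\<Sum>y\<in>nb z. mu z y * (f y)\<^sup>2)"
    unfolding mu_v_def
    by (intro arg_cong2[of _ _ _ _ "(*)"] sum.cong) (auto simp: mu_pos less_imp_le power_mult_distrib)
  finally show ?thesis using m_pos[of z]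
    by (simp add: avg_def power_divide power2_eq_square[of "m z"] divide_simps mult_ac)
qed

text \<open>The diagonal value at time 2 n is the squared L2 norm, weighted by \<open>m\<close>, of
  the kernel at time n, and averaging contracts that norm.\<close>

lemma hk_diag_Suc_le: "hk E mu (2 * Suc n) x x \<le> hk E mu (2 * n) x x"
proof -
  obtain S where S: "finite S" "\<And>k z. k \<le> 2 * Suc n \<Longrightarrow> z \<notin> S \<Longrightarrow> hk E mu k x z = 0"
    using ex_hk_support[of "2 * Suc n" x] by blast
  have "hk E mu (2 * Suc n) x x = (\<Sum>z\<in>S. (hk E mu (Suc n) x z)\<^sup>2 * m z)"
    using hk_semigroup[of S "Suc n" "Suc n" x] S by (simp add: power2_eq_square mult_2)
  also have "\<dots> \<le> (\<Sum>z\<in>S. avg (\<lambda>y. (hk E mu n x y)\<^sup>2) z * m z)"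
    unfolding hk_Suc using m_pos by (intro sum_mono mult_right_mono avg_square_le) (simp add: less_imp_le)
  also have "\<dots> \<le> (\<Sum>z\<in>S. (hk E mu n x z)\<^sup>2 * m z)"
    using S by (intro sum_avg_le) auto
  also have "\<dots> = hk E mu (2 * n) x x"
    using hk_semigroup[of S n n x] S by (simp add: power2_eq_square mult_2)
  finally show ?thesis .
qed

lemma hk_diag_antimono: "i \<le> j \<Longrightarrow> hk E mu (2 * j) x x \<le> hk E mu (2 * i) x x"
  using hk_diag_Suc_le by (rule lift_Suc_antimono_le)

section \<open>The truncated Green function and the heat kernel on the diagonal\<close>

definition green :: "nat \<Rightarrow> 'a \<Rightarrow> 'a \<Rightarrow> real" where
  "green M x z = (\<Sum>k<M. hk E mu k x z)"

lemma green_nonneg: "0 \<le> green M x z"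
  unfolding green_def by (intro sum_nonneg hk_nonneg)

text \<open>Averaging advances every summand by one time step, so the difference telescopes.\<close>

lemma lap_green: "lap (green M x) z = m z * (hk E mu 0 x z - hk E mu M x z)"
proof -
  have "avg (green M x) z = (\<Sum>k<M. hk E mu (Suc k) x z)"
    unfolding hk_Suc avg_def green_def sum_distrib_left
    by (subst sum.swap) (simp add: sum_divide_distrib)
  then show ?thesis
    unfolding lap_eq_avg using sum_lessThan_telescope'[of "\<lambda>k. hk E mu k x z" M]
    by (simp add: green_def sum_subtractf)
qed

text \<open>Summation by parts leaves the value at x minus nonnegative terms that carry the kernel
  at time M.\<close>

lemma energy_green: "energy E mu (green M x) \<le> ennreal (green M x x)"
proof -
  obtain S where S: "finite S" "\<And>k z. k \<le> M \<Longrightarrow> z \<notin> S \<Longrightarrow> hk E mu k x z = 0"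
    using ex_hk_support[of M x] by blast
  have x: "x \<in> S" using S(2)[of 0 x] m_pos[of x] by (auto simp: hk_0)
  have G: "green M x z = 0" if "z \<notin> S" for z
    using S(2) that by (simp add: green_def)
  have "dform S (green M x) (green M x) = (\<Sum>z\<in>S. green M x z * (m z * (hk E mu 0 x z - hk E mu M x z)))"
    using S(1) G by (subst dform_eq_lap) (auto simp: lap_green)
  also have "\<dots> \<le> (\<Sum>z\<in>S. if x = z then green M x x else 0)"
    using m_pos green_nonneg hk_nonneg
    by (intro sum_mono) (auto simp: hk_0 right_diff_distrib less_imp_le)
  also have "\<dots> = green M x x" using x S(1) by simp
  finally show ?thesis using S(1) G by (simp add: energy_eq_dform ennreal_leI)
qed

lemma green_mass: "finite T \<Longrightarrow> (\<Sum>z\<in>T. green M x z * m z) \<le> real M"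
proof -
  assume T: "finite T"
  have "(\<Sum>z\<in>T. green M x z * m z) = (\<Sum>k<M. \<Sum>z\<in>T. hk E mu k x z * m z)"
    unfolding green_def sum_distrib_right by (rule sum.swap)
  also have "\<dots> \<le> (\<Sum>k<M. 1)" by (intro sum_mono hk_mass T)
  finally show ?thesis by simp
qed

text \<open>The Green function has mass at most \<open>M\<close>, so it is at most \<open>\<rho>\<close> somewhere in the ball; its
  energy is at most its value at \<open>x\<close>, which bounds its oscillation on the ball.\<close>

lemma green_diag_le:
  assumes "0 < \<rho>" "finite (mball R x \<rho>)" "real M \<le> \<rho> * (\<Sum>z\<in>mball R x \<rho>. m z)"
  shows "green M x x \<le> 3 * \<rho>"
proof -
  let ?B = "mball R x \<rho>" and ?g = "green M x x"
  have x: "x \<in> ?B" using assms(1) by (simp add: mball_def)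
  have "\<exists>y\<in>?B. green M x y \<le> \<rho>"
  proof (rule ccontr)
    assume "\<not> ?thesis"
    then have "\<rho> * m y < green M x y * m y" if "y \<in> ?B" for y
      using that m_pos[of y] by auto
    then have "(\<Sum>y\<in>?B. \<rho> * m y) < (\<Sum>y\<in>?B. green M x y * m y)"
      using assms(2) x by (intro sum_strict_mono) auto
    then show False using green_mass[OF assms(2), of M x] assms(3) by (simp add: sum_distrib_left)
  qed
  then obtain y where y: "R x y < \<rho>" "green M x y \<le> \<rho>" by (auto simp: mball_def)
  have "(?g - green M x y)\<^sup>2 \<le> R x y * ?g"
    by (rule osc_le[OF green_nonneg energy_green])
  also have "\<dots> \<le> \<rho> * ?g" using y(1) green_nonneg by (intro mult_right_mono) auto
  finally have *: "(?g - green M x y)\<^sup>2 \<le> \<rho> * ?g" .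
  show ?thesis
  proof (rule ccontr)
    assume c: "\<not> ?thesis"
    \<comment> \<open>\<open>?g\<close> > 3 * \<rho> and \<open>green M x y\<close> \<le> \<rho>
      leave a gap of at least 2/3 of \<open>?g\<close>; squaring it bounds \<open>?g\<close> by 9/4
      of \<rho>, a contradiction.\<close>
    then have "(2 / 3 * ?g)\<^sup>2 \<le> (?g - green M x y)\<^sup>2"
      using y(2) assms(1) by (intro power_mono) auto
    then have "4 / 9 * ?g * ?g \<le> \<rho> * ?g" using * by (simp add: power2_eq_square)
    moreover have "0 < ?g" using c assms(1) by simp
    ultimately have "4 / 9 * ?g \<le> \<rho>" by (rule mult_right_le_imp_le)
    then show False using c assms(1) by simp
  qed
qed

text \<open>The n even times 0, 2, ..., 2 n - 2 lie below 2 n, and by monotonicity each contributes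
  at least the value at time 2 n.\<close>

lemma hk_diag_le_green: "real n * hk E mu (2 * n) x x \<le> green (2 * n) x x"
proof -
  have "real n * hk E mu (2 * n) x x = (\<Sum>j<n. hk E mu (2 * n) x x)" by simp
  also have "\<dots> \<le> (\<Sum>j<n. hk E mu (2 * j) x x)"
    by (intro sum_mono hk_diag_antimono) auto
  also have "\<dots> = (\<Sum>k\<in>(*) 2 ` {..<n}. hk E mu k x x)"
    by (subst sum.reindex) (auto simp: inj_on_def)
  also have "\<dots> \<le> green (2 * n) x x"
    unfolding green_def by (intro sum_mono2 hk_nonneg) auto
  finally show ?thesis .
qed

text \<open>Testing \<open>lap (green n x) = m (hk 0 x - hk n x)\<close> against the cutoff \<open>f\<close> shows that the walk is
  still in \<open>B\<close> at time \<open>n\<close> with probability at least one half.\<close>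

lemma hk_diag_lower:
  assumes B: "finite B" "\<And>z. z \<notin> B \<Longrightarrow> f z = 0" and f: "f x = 1" "\<And>z. \<bar>f z\<bar> \<le> 1"
    and e: "0 \<le> e" "energy E mu f \<le> ennreal e" "e * green n x x \<le> 1 / 4"
  shows "1 / 4 \<le> hk E mu (2 * n) x x * (\<Sum>z\<in>B. m z)"
proof -
  obtain S0 where S0: "finite S0" "\<And>k z. k \<le> 2 * n \<Longrightarrow> z \<notin> S0 \<Longrightarrow> hk E mu k x z = 0"
    using ex_hk_support[of "2 * n" x] by blast
  define S where "S = S0 \<union> B"
  have S: "finite S" "\<And>k z. k \<le> 2 * n \<Longrightarrow> z \<notin> S \<Longrightarrow> hk E mu k x z = 0" "\<And>z. z \<notin> S \<Longrightarrow> f z = 0"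
    using S0 B by (auto simp: S_def)
  have x: "x \<in> S" using S(2)[of 0 x] m_pos[of x] by (auto simp: hk_0)
  have G: "green n x z = 0" if "z \<notin> S" for z
    using S(2) that by (simp add: green_def)
  let ?a = "\<Sum>z\<in>S. f z * hk E mu n x z * m z"
  have "dform S f (green n x) = (\<Sum>z\<in>S. f z * (m z * (hk E mu 0 x z - hk E mu n x z)))"
    using S(1,3) by (subst dform_eq_lap) (auto simp: lap_green)
  also have "\<dots> = (\<Sum>z\<in>S. (if x = z then 1 else 0) - f z * hk E mu n x z * m z)"
    using f(1) m_pos[of x] by (intro sum.cong) (auto simp: hk_0 field_simps)
  also have "\<dots> = 1 - ?a" using x S(1) by (simp add: sum_subtractf)
  finally have a: "dform S f (green n x) = 1 - ?a" .
  have "(1 - ?a)\<^sup>2 \<le> dform S f f * dform S (green n x) (green n x)"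
    unfolding a[symmetric] by (rule dform_Cauchy_Schwarz)
  also have "\<dots> \<le> e * green n x x"
  proof (intro mult_mono dform_nonneg e(1))
    show "dform S f f \<le> e" using e(1,2) S(1,3) by (simp add: energy_eq_dform ennreal_le_iff)
    show "dform S (green n x) (green n x) \<le> green n x x"
      using energy_green[of n x] S(1) G green_nonneg by (simp add: energy_eq_dform ennreal_le_iff)
  qed
  finally have "(1 - ?a)\<^sup>2 \<le> (1 / 2)\<^sup>2" using e(3) by (simp add: power2_eq_square)
  then have "\<bar>1 - ?a\<bar> \<le> 1 / 2" 
    by (simp only: abs_le_square_iff[symmetric])
  then have a2: "1 / 2 \<le> ?a" by linarith
  \<comment> \<open>Cauchy-Schwarz converts the \<open>f\<close>-weighted mass at time n into a
    return probability: the squared kernel at time n sums to the diagonal value at time 2 n.\<close>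
  have "?a\<^sup>2 = (\<Sum>z\<in>S. (f z * sqrt (m z)) * (hk E mu n x z * sqrt (m z)))\<^sup>2"
    using m_pos by (intro arg_cong[of _ _ "\<lambda>a. a\<^sup>2"] sum.cong) (auto simp: less_imp_le)
  also have "\<dots> \<le> (\<Sum>z\<in>S. (f z * sqrt (m z))\<^sup>2) * (\<Sum>z\<in>S. (hk E mu n x z * sqrt (m z))\<^sup>2)"
    by (rule Cauchy_Schwarz_ineq_sum)
  also have "(\<Sum>z\<in>S. (hk E mu n x z * sqrt (m z))\<^sup>2) = hk E mu (2 * n) x x"
    using hk_semigroup[of S n n x] S m_pos
    by (simp add: power2_eq_square[of "hk _ _ _ _ _"] power_mult_distrib mult_2 less_imp_le)
  also have "(\<Sum>z\<in>S. (f z * sqrt (m z))\<^sup>2) = (\<Sum>z\<in>B. (f z)\<^sup>2 * m z)"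
    using m_pos S(1) B(2)
    by (intro sum.mono_neutral_cong_right) (auto simp: power_mult_distrib less_imp_le S_def)
  also have "(\<Sum>z\<in>B. (f z)\<^sup>2 * m z) * hk E mu (2 * n) x x \<le> (\<Sum>z\<in>B. m z) * hk E mu (2 * n) x x"
    using m_pos f(2) by (intro mult_right_mono hk_nonneg sum_mono) (auto simp: abs_square_le_1)
  finally have "?a\<^sup>2 \<le> (\<Sum>z\<in>B. m z) * hk E mu (2 * n) x x" .
  moreover have "(1 / 2)\<^sup>2 \<le> ?a\<^sup>2" using a2 by (intro power_mono) auto
  ultimately show ?thesis by (simp add: power2_eq_square mult.commute)
qed

end

subsection \<open>Cutoff functions under volume doubling\<close>

lemma (in conductance_graph) vol_finite: "finite A \<Longrightarrow> vol E mu A = ennreal (\<Sum>z\<in>A. m z)"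
  unfolding vol_def using m_pos by (simp add: nn_integral_count_space_finite less_imp_le)

text \<open>With doubling constant 2 ^ D, the number D is a growth exponent for volumes; D >= 1
  keeps the exponent \<alpha> built from it at least 1.\<close>

locale doubling_resistance_graph = conductance_graph +
  fixes p0 :: real and D :: nat
  assumes p0_pos: "0 < p0" and p0_le: "E x y \<Longrightarrow> p0 \<le> mu x y / mu_v E mu x"
    and D_ge_1: "1 \<le> D"
    and vol_doubling: "0 < s \<Longrightarrow> Vball E mu (res_metric E mu) x (2 * s)
      \<le> ennreal (2 ^ D) * Vball E mu (res_metric E mu) x s"
    and vol_finite_ball: "0 < s \<Longrightarrow> Vball E mu (res_metric E mu) x s < \<infinity>"
begin

abbreviation bR :: "'a \<Rightarrow> real \<Rightarrow> 'a set" where "bR \<equiv> mball R"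

text \<open>By \<open>R_ge\<close> every vertex y of the ball other than x has \<open>m y\<close> >=
  1 / r, so infinitely many of them would have infinite volume.\<close>

lemma finite_bR: "finite (bR x r)"
proof (cases "0 < r")
  case True
  define c where "c = min (m x) (1 / r)"
  have c: "0 < c" using True m_pos[of x] by (simp add: c_def)
  have c_le: "c \<le> m y" if "y \<in> bR x r" for y
  proof (cases "y = x")
    case False
    then have "1 / m y < r" using R_ge[of y x] that by (simp add: mball_def R_sym)
    then have "1 / r \<le> m y" using True m_pos[of y] by (simp add: field_simps)
    then show ?thesis by (simp add: c_def)
  qed (simp add: c_def)
  show ?thesis
  proof (rule ccontr)
    assume "infinite (bR x r)"
    then have "\<infinity> = (\<integral>\<^sup>+ y. ennreal c \<partial>count_space (bR x r))"
      using c by (simp add: ennreal_mult_top)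
    also have "\<dots> \<le> Vball E mu R x r"
      unfolding Vball_def vol_def using c_le by (intro nn_integral_mono ennreal_leI) simp
    finally show False using vol_finite_ball[OF True, of x] by simp
  qed
next
  case False
  then have "bR x r = {}" using R_nonneg[of x] by (auto simp: mball_def not_less intro: order_trans)
  then show ?thesis by simp
qed

section \<open>Volume growth of resistance balls\<close>

definition V :: "'a \<Rightarrow> real \<Rightarrow> real" where "V x r = (\<Sum>z\<in>bR x r. m z)"

lemma Vball_R: "Vball E mu R x r = ennreal (V x r)"
  by (simp add: Vball_def V_def vol_finite finite_bR)

lemma V_nonneg: "0 \<le> V x r"
  unfolding V_def using m_pos by (intro sum_nonneg) (simp add: less_imp_le)

lemma sum_m_mono: "finite B \<Longrightarrow> A \<subseteq> B \<Longrightarrow> (\<Sum>z\<in>A. m z) \<le> (\<Sum>z\<in>B. m z)"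
  using m_pos by (intro sum_mono2) (auto simp: less_imp_le)

lemma V_subset: "bR x r \<subseteq> bR y s \<Longrightarrow> V x r \<le> V y s"
  unfolding V_def by (intro sum_m_mono finite_bR)

lemma V_mono: "r \<le> s \<Longrightarrow> V x r \<le> V x s"
  by (intro V_subset) (auto simp: mball_def)

lemma m_le_V: "0 < r \<Longrightarrow> m x \<le> V x r"
  using sum_m_mono[OF finite_bR, of "{x}" x r] by (simp add: V_def mball_def)

lemma V_pos: "0 < r \<Longrightarrow> 0 < V x r"
  using m_le_V[of r x] m_pos[of x] by linarith

lemma V_double: "0 < r \<Longrightarrow> V x (2 * r) \<le> 2 ^ D * V x r"
  using vol_doubling[of r x] V_nonneg
  by (simp add: Vball_R ennreal_mult[symmetric] ennreal_le_iff)

lemma V_double_pow: "0 < r \<Longrightarrow> V x (2 ^ k * r) \<le> (2 ^ k) ^ D * V x r"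
proof (induction k)
  case (Suc k)
  have "V x (2 ^ Suc k * r) \<le> 2 ^ D * V x (2 ^ k * r)"
    using V_double[of "2 ^ k * r" x] Suc.prems by (simp add: mult.assoc)
  also have "\<dots> \<le> 2 ^ D * ((2 ^ k) ^ D * V x r)" using Suc by simp
  finally show ?case by (simp add: power_mult_distrib mult_ac)
qed simp

lemma V_scale:
  assumes "1 \<le> A" "0 < r" shows "V x (A * r) \<le> (2 * A) ^ D * V x r"
proof -
  \<comment> \<open>Minimality gives 2 ^ k <= 2 * A: rounding A up to a power of two explains the
    factor 2.\<close>
  define k where "k = (LEAST k. A \<le> 2 ^ k)"
  have "\<exists>k. A \<le> 2 ^ k" using real_arch_pow[of 2 A] by (auto intro: less_imp_le)
  then have k: "A \<le> 2 ^ k" unfolding k_def by (rule LeastI_ex)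
  have k2: "2 ^ k \<le> 2 * A"
  proof (cases k)
    case (Suc j)
    then have "\<not> A \<le> 2 ^ j" unfolding k_def by (intro not_less_Least) auto
    then show ?thesis using Suc by simp
  qed (use assms in simp)
  have "V x (A * r) \<le> V x (2 ^ k * r)" using k assms by (intro V_mono mult_right_mono) auto
  also have "\<dots> \<le> (2 ^ k) ^ D * V x r" by (rule V_double_pow[OF assms(2)])
  also have "\<dots> \<le> (2 * A) ^ D * V x r"
    using k2 by (intro mult_right_mono power_mono V_nonneg) auto
  finally show ?thesis .
qed

lemma V_shift:
  assumes "R x y \<le> r" "0 < r" shows "V y r \<le> 8 ^ D * V x r"
proof -
  have "bR y r \<subseteq> bR x (4 * r)"
  proof
    fix u assume "u \<in> bR y r"
    then show "u \<in> bR x (4 * r)" using R_quasi_triangle[of x u y] assms(1) by (simp add: mball_def)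
  qed
  then have "V y r \<le> V x (4 * r)" by (rule V_subset)
  also have "\<dots> \<le> (2 * 4) ^ D * V x r" using assms(2) by (intro V_scale) auto
  finally show ?thesis by simp
qed

section \<open>Radius times volume as a time scale\<close>

definition \<Phi> :: "'a \<Rightarrow> real \<Rightarrow> real" where "\<Phi> x r = r * V x r"

lemma \<Phi>_pos: "0 < r \<Longrightarrow> 0 < \<Phi> x r"
  using V_pos by (simp add: \<Phi>_def)

lemma \<Phi>_strict_mono: "0 \<le> r \<Longrightarrow> r < s \<Longrightarrow> \<Phi> x r < \<Phi> x s"
  unfolding \<Phi>_def using V_mono[of r s x] V_pos[of s x] V_nonneg[of x r]
  by (smt (verit) mult_less_cancel_right mult_left_mono)

lemma \<Phi>_mono: "0 \<le> r \<Longrightarrow> r \<le> s \<Longrightarrow> \<Phi> x r \<le> \<Phi> x s"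
  using \<Phi>_strict_mono[of r s x] by (cases "r = s") auto

lemma \<Phi>_less_D: "\<Phi> x r < \<Phi> x s \<Longrightarrow> 0 \<le> s \<Longrightarrow> r < s"
  using \<Phi>_mono[of s r x] by (cases "r < s") auto

text \<open>Volume increases with the radius, so growth is at least linear. With the polynomial
  bound \<open>\<Phi>_scale_le\<close>, radii can be recovered from values of \<Phi> up to
  constants.\<close>

lemma \<Phi>_scale_ge: "1 \<le> A \<Longrightarrow> 0 \<le> r \<Longrightarrow> A * \<Phi> x r \<le> \<Phi> x (A * r)"
proof -
  assume "1 \<le> A" "0 \<le> r"
  then have "1 * r \<le> A * r" by (intro mult_right_mono)
  then have "V x r \<le> V x (A * r)" by (intro V_mono) simp
  then have "A * r * V x r \<le> A * r * V x (A * r)" using \<open>1 \<le> A\<close> \<open>0 \<le> r\<close> by (intro mult_left_mono) auto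
  then show ?thesis by (simp add: \<Phi>_def mult.assoc)
qed

lemma \<Phi>_scale_le:
  assumes "1 \<le> A" "0 < r" shows "\<Phi> x (A * r) \<le> (2 * A) ^ Suc D * \<Phi> x r"
proof -
  have "\<Phi> x (A * r) \<le> A * r * ((2 * A) ^ D * V x r)"
    unfolding \<Phi>_def using V_scale[OF assms] assms by (intro mult_left_mono) auto
  also have "\<dots> \<le> (2 * A) * (r * ((2 * A) ^ D * V x r))"
    using assms V_nonneg[of x r] by (simp add: mult_left_mono mult.assoc)
  finally show ?thesis by (simp add: \<Phi>_def mult_ac)
qed

lemma \<Phi>_shift:
  assumes "R x y \<le> r" "0 < r" shows "\<Phi> y r \<le> 8 ^ D * \<Phi> x r"
  using V_shift[OF assms] assms(2) by (simp add: \<Phi>_def mult.left_commute)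

lemma bR_small: "0 < r \<Longrightarrow> r \<le> 1 / m x \<Longrightarrow> bR x r = {x}"
  using R_ge[of x] by (force simp: mball_def not_less)

text \<open>Fixes the unit: at the resistance scale of a single vertex the ball is {x}, of volume
  \<open>m x\<close>.\<close>

lemma \<Phi>_inverse_m: "\<Phi> x (1 / m x) = 1"
  using bR_small[of "1 / m x" x] m_pos[of x] by (simp add: \<Phi>_def V_def)

text \<open>Condition (p0) in terms of resistance: an edge at w exceeds the lower bound of
  \<open>R_ge\<close> at most by a constant factor.\<close>

lemma R_edge_le_m: "E w z \<Longrightarrow> R w z \<le> 2 / p0 * (1 / m w)"
proof -
  assume wz: "E w z"
  have "p0 * m w \<le> mu w z" using p0_le[OF wz] m_pos[of w] by (simp add: field_simps)
  then have "2 / mu w z \<le> 2 / (p0 * m w)"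
    using p0_pos m_pos[of w] by (intro divide_left_mono) (auto simp: mu_pos[OF wz])
  then show ?thesis using R_edge_le[OF wz] by simp
qed

text \<open>An edge leaving the ball overshoots by a constant factor only, because 1 /
  \<open>m w\<close> <= r: by \<open>R_ge\<close> if w differs from x, by the first assumption
  otherwise.\<close>

lemma R_exit_le:
  assumes "1 / m x \<le> r" "R x w < r" "E w z"
  shows "R x z \<le> (2 + 4 / p0) * r"
proof -
  have "1 / m w \<le> r"
    using assms R_ge[of w x] by (cases "w = x") (auto simp: R_sym)
  then have "R w z \<le> 2 / p0 * r"
    using R_edge_le_m[OF assms(3)] p0_pos by (smt (verit) mult_left_mono divide_nonneg_pos)
  then have "2 * (R x w + R w z) \<le> 2 * (r + 2 / p0 * r)"
    using assms(2) by (intro mult_left_mono add_mono) auto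
  also have "\<dots> = (2 + 4 / p0) * r" by (simp add: algebra_simps)
  finally show ?thesis using R_quasi_triangle[of x z w] by linarith
qed

text \<open>Packing: the balls of radius \<delta> / 4 around the points are disjoint, as 2 *
  (\<delta> / 4 + \<delta> / 4) = \<delta>, they lie in \<open>bR x (3 * r)\<close>, and by doubling
  each carries a fixed fraction of its volume.\<close>

lemma separated_card_le:
  assumes "finite Y" "\<And>y. y \<in> Y \<Longrightarrow> R x y \<le> r" "0 < \<delta>" "\<delta> \<le> r"
    and sep: "\<And>y y'. y \<in> Y \<Longrightarrow> y' \<in> Y \<Longrightarrow> y \<noteq> y' \<Longrightarrow> \<delta> \<le> R y y'"
  shows "real (card Y) \<le> (64 * r / \<delta>) ^ D"
proof -
  let ?K = "(64 * r / \<delta>) ^ D"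
  have r: "0 < r" using assms by linarith
  have disj: "bR y (\<delta> / 4) \<inter> bR y' (\<delta> / 4) = {}" if "y \<in> Y" "y' \<in> Y" "y \<noteq> y'" for y y'
  proof (rule ccontr)
    assume "\<not> ?thesis"
    then obtain u where "R y u < \<delta> / 4" "R y' u < \<delta> / 4" by (auto simp: mball_def)
    then show False using sep[OF that] R_quasi_triangle[of y y' u] by (simp add: R_sym)
  qed
  have big: "V x (3 * r) \<le> ?K * V y (\<delta> / 4)" if "y \<in> Y" for y
  proof -
    have "bR x (3 * r) \<subseteq> bR y (8 * r)"
    proof
      fix u assume "u \<in> bR x (3 * r)"
      then show "u \<in> bR y (8 * r)"
        using R_quasi_triangle[of y u x] assms(2)[OF that] by (simp add: mball_def R_sym)
    qed
    then have "V x (3 * r) \<le> V y (8 * r)" by (rule V_subset)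
    also have "8 * r = (32 * r / \<delta>) * (\<delta> / 4)" using assms(3) by simp
    also have "V y \<dots> \<le> (2 * (32 * r / \<delta>)) ^ D * V y (\<delta> / 4)"
      using assms(3,4) by (intro V_scale) (auto simp: field_simps)
    finally show ?thesis by simp
  qed
  have "(\<Sum>y\<in>Y. V y (\<delta> / 4)) = (\<Sum>z\<in>(\<Union>y\<in>Y. bR y (\<delta> / 4)). m z)"
    unfolding V_def using assms(1) finite_bR disj by (intro sum.UNION_disjoint[symmetric]) auto
  also have "\<dots> \<le> V x (3 * r)"
    unfolding V_def
  proof (intro sum_m_mono finite_bR subsetI)
    fix u assume "u \<in> (\<Union>y\<in>Y. bR y (\<delta> / 4))"
    then obtain y where "y \<in> Y" "R y u < \<delta> / 4" by (auto simp: mball_def)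
    then show "u \<in> bR x (3 * r)"
      using R_quasi_triangle[of x u y] assms(2)[of y] assms(3,4) by (simp add: mball_def)
  qed
  finally have 1: "(\<Sum>y\<in>Y. V y (\<delta> / 4)) \<le> V x (3 * r)" .
  have "real (card Y) * V x (3 * r) = (\<Sum>y\<in>Y. V x (3 * r))" by simp
  also have "\<dots> \<le> (\<Sum>y\<in>Y. ?K * V y (\<delta> / 4))" by (intro sum_mono big)
  also have "\<dots> = ?K * (\<Sum>y\<in>Y. V y (\<delta> / 4))" by (simp add: sum_distrib_left)
  also have "\<dots> \<le> ?K * V x (3 * r)" using 1 r assms(3) by (intro mult_left_mono) auto
  finally show ?thesis using V_pos[of "3 * r" x] r by simp
qed

lemma ex_maximal_separated:
  assumes "finite A" "0 < \<delta>"
  shows "\<exists>Y\<subseteq>A. (\<forall>y\<in>Y. \<forall>y'\<in>Y. y \<noteq> y' \<longrightarrow> \<delta> \<le> R y y') \<and> (\<forall>z\<in>A. \<exists>y\<in>Y. R y z < \<delta>)"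
  using assms(1)
proof (induction A)
  case (insert a A)
  then obtain Y where Y: "Y \<subseteq> A" "\<forall>y\<in>Y. \<forall>y'\<in>Y. y \<noteq> y' \<longrightarrow> \<delta> \<le> R y y'"
    "\<forall>z\<in>A. \<exists>y\<in>Y. R y z < \<delta>" by blast
  show ?case
  proof (cases "\<exists>y\<in>Y. R y a < \<delta>")
    case True
    then show ?thesis using Y by (intro exI[of _ Y]) auto
  next
    case False
    then have "\<delta> \<le> R y a" "\<delta> \<le> R a y" if "y \<in> Y" for y
      using that R_sym[of a y] by (auto simp: not_less)
    then show ?thesis using Y assms(2) by (intro exI[of _ "insert a Y"]) auto
  qed
qed simp

text \<open>With N = (2048 * (2 + 4 / p0)) ^ D bounding the number of cover points this is 8 * N^2:
  N functions of energy at most 2 / r, a factor 4 from the slope 2 of the truncation, another N from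
  Cauchy-Schwarz.\<close>

definition Ccut :: real where "Ccut = 8 * ((2048 * (2 + 4 / p0)) ^ D)\<^sup>2"

lemma Ccut_ge_1: "1 \<le> Ccut"
proof -
  have "1 \<le> (2048 * (2 + 4 / p0)) ^ D" using p0_pos by (intro one_le_power) (simp add: field_simps)
  then have "1 \<le> ((2048 * (2 + 4 / p0)) ^ D)\<^sup>2" by (rule one_le_power)
  then show ?thesis by (simp add: Ccut_def)
qed

text \<open>The outer boundary of a ball is covered by boundedly many small balls; the cutoff is the product
  of truncated near-minimizers for the resistance between the centre and the centres of the cover.\<close>

lemma ex_cutoff:
  assumes r: "0 < r"
  shows "\<exists>f. (\<forall>z. 0 \<le> f z \<and> f z \<le> 1) \<and> (\<forall>z\<in>bR x (r / 32). f z = 1) \<and> (\<forall>z. z \<notin> bR x r \<longrightarrow> f z = 0)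
    \<and> energy E mu f \<le> ennreal (Ccut / r)"
proof (cases "r \<le> 1 / m x")
  case True
  then have b: "bR x r = {x}" "bR x (r / 32) = {x}"
    using r bR_small[of r x] bR_small[of "r / 32" x] by auto
  have "m x \<le> Ccut / r" using True r m_pos[of x] Ccut_ge_1 by (simp add: field_simps)
  then show ?thesis using b
    by (intro exI[of _ "\<lambda>z. if z = x then 1 else 0"]) (auto simp: energy_indicator intro: ennreal_leI)
next
  case False
  \<comment> \<open>The outer vertex boundary of the ball, kept within a multiple of r by
    \<open>R_exit_le\<close>.\<close>
  define A where "A = (\<Union>w\<in>bR x r. nb w) - bR x r"
  have finA: "finite A" unfolding A_def using finite_bR locally_finite by auto
  have RA: "r \<le> R x z" "R x z \<le> (2 + 4 / p0) * r" if "z \<in> A" for z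
    using that R_exit_le[of x r _ z] False by (auto simp: A_def mball_def)
  obtain Y where Y: "Y \<subseteq> A" "\<And>y y'. y \<in> Y \<Longrightarrow> y' \<in> Y \<Longrightarrow> y \<noteq> y' \<Longrightarrow> r / 32 \<le> R y y'"
    "\<And>z. z \<in> A \<Longrightarrow> \<exists>y\<in>Y. R y z < r / 32"
    using ex_maximal_separated[OF finA, of "r / 32"] r by auto
  have finY: "finite Y" using Y(1) finA by (rule finite_subset)
  let ?N = "(2048 * (2 + 4 / p0)) ^ D"
  have card: "real (card Y) \<le> ?N"
  proof -
    have "r / 32 \<le> (2 + 4 / p0) * r" using r p0_pos by (simp add: field_simps)
    then have "real (card Y) \<le> (64 * ((2 + 4 / p0) * r) / (r / 32)) ^ D"
      using Y RA r finY by (intro separated_card_le[of _ x]) auto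
    also have "64 * ((2 + 4 / p0) * r) / (r / 32) = 2048 * (2 + 4 / p0)"
      using r p0_pos by (simp add: field_simps)
    finally show ?thesis .
  qed
  have "\<forall>y\<in>Y. \<exists>f. f x = 1 \<and> f y = 0 \<and> energy E mu f \<le> ennreal (2 / r)"
    using ex_near_minimizer[OF r] RA(1) Y(1) by blast
  then obtain f where f: "\<And>y. y \<in> Y \<Longrightarrow> f y x = 1" "\<And>y. y \<in> Y \<Longrightarrow> f y y = 0"
    "\<And>y. y \<in> Y \<Longrightarrow> energy E mu (f y) \<le> ennreal (2 / r)" by metis
  \<comment> \<open>The radius r / 32 is tuned to the energy 2 / r: their product 1 / 16 is the
    square of 1 / 4.\<close>
  have osc: "\<bar>f y u - f y v\<bar> \<le> 1 / 4" if "y \<in> Y" "R u v < r / 32" for y u v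
  proof -
    have "(f y u - f y v)\<^sup>2 \<le> R u v * (2 / r)" using osc_le[OF _ f(3)[OF that(1)]] r by simp
    also have "\<dots> \<le> r / 32 * (2 / r)" using that(2) r by (intro mult_right_mono) auto
    also have "\<dots> = (1 / 4)\<^sup>2" using r by (simp add: power2_eq_square)
    finally show ?thesis by (simp only: abs_le_square_iff[symmetric] abs_of_nonneg)
  qed
  \<comment> \<open>The truncation is 1 where \<open>f y\<close> >= 3 / 4 and 0 where
    \<open>f y\<close> <= 1 / 4, as happens near x and near y respectively.\<close>
  define g where "g y z = max 0 (min 1 (2 * f y z - 1 / 2))" for y z
  define h where "h z = (if z \<in> bR x r then (\<Prod>y\<in>Y. g y z) else 0)" for z
  have g01: "0 \<le> g y z" "g y z \<le> 1" for y z by (auto simp: g_def)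
  have h01: "0 \<le> h z" "h z \<le> 1" for z using g01 by (auto simp: h_def intro: prod_nonneg prod_le_1)
  have h1: "h z = 1" if "z \<in> bR x (r / 32)" for z
  proof -
    have "g y z = 1" if "y \<in> Y" for y
    proof -
      have "\<bar>1 - f y z\<bar> \<le> 1 / 4"
        using osc[OF that, of x z] f(1)[OF that] \<open>z \<in> bR x (r / 32)\<close> by (simp add: mball_def)
      then have "1 \<le> 2 * f y z - 1 / 2" unfolding abs_le_iff by linarith
      then show ?thesis by (simp add: g_def)
    qed
    moreover have "z \<in> bR x r" using that r by (simp add: mball_def)
    ultimately show ?thesis by (simp add: h_def)
  qed
  have gA: "(\<Prod>y\<in>Y. g y z) = 0" if "z \<in> A" for z
  proof -
    obtain y where y: "y \<in> Y" "R y z < r / 32" using Y(3) \<open>z \<in> A\<close> by blast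
    then have "\<bar>0 - f y z\<bar> \<le> 1 / 4" using osc[of y y z] f(2) by simp
    then have "2 * f y z - 1 / 2 \<le> 0" unfolding abs_le_iff by linarith
    then have "g y z = 0" by (simp add: g_def)
    then show ?thesis using y(1) finY by (auto simp: prod_zero_iff)
  qed
  have diff: "(h u - h v)\<^sup>2 \<le> (\<Sum>y\<in>Y. 4 * ?N * (f y u - f y v)\<^sup>2)" if uv: "E u v" for u v
  proof -
    \<comment> \<open>An edge leaving the ball ends in \<open>A\<close>, where the product vanishes
      already, so cutting off outside the ball adds no increment.\<close>
    have "\<bar>h u - h v\<bar> \<le> \<bar>(\<Prod>y\<in>Y. g y u) - (\<Prod>y\<in>Y. g y v)\<bar>"
    proof -
      have "u \<in> A" if "v \<in> bR x r" "u \<notin> bR x r" using that E_sym[OF uv] by (auto simp: A_def)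
      moreover have "v \<in> A" if "u \<in> bR x r" "v \<notin> bR x r" using that uv by (auto simp: A_def)
      ultimately show ?thesis using gA by (auto simp: h_def)
    qed
    also have "\<dots> \<le> (\<Sum>y\<in>Y. \<bar>g y u - g y v\<bar>)"
      using norm_prod_diff[of Y "\<lambda>y. g y u" "\<lambda>y. g y v"] g01 by simp
    also have "\<dots> \<le> (\<Sum>y\<in>Y. \<bar>2 * (f y u - f y v)\<bar>)"
      by (intro sum_mono) (auto simp: g_def)
    finally have "(h u - h v)\<^sup>2 \<le> (\<Sum>y\<in>Y. \<bar>2 * (f y u - f y v)\<bar>)\<^sup>2"
      by (metis abs_ge_zero power2_abs power_mono)
    also have "\<dots> \<le> (\<Sum>y\<in>Y. \<bar>2 * (f y u - f y v)\<bar>\<^sup>2) * card Y"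
      by (rule sum_squared_le_sum_of_squares)
    also have "\<dots> \<le> (\<Sum>y\<in>Y. \<bar>2 * (f y u - f y v)\<bar>\<^sup>2) * ?N"
      using card by (intro mult_left_mono sum_nonneg) auto
    also have "\<dots> = (\<Sum>y\<in>Y. 4 * ?N * (f y u - f y v)\<^sup>2)"
      unfolding sum_distrib_right power2_abs power_mult_distrib[of 2 "f _ u - f _ v"]
      by (intro sum.cong refl) simp
    finally show ?thesis .
  qed
  have "energy E mu h \<le> (\<Sum>y\<in>Y. ennreal (4 * ?N) * energy E mu (f y))"
    using finY diff p0_pos by (intro energy_le_sum) auto
  also have "\<dots> \<le> (\<Sum>y\<in>Y. ennreal (4 * ?N) * ennreal (2 / r))"
    by (intro sum_mono mult_left_mono f(3)) auto
  also have "\<dots> = (\<Sum>y\<in>Y. ennreal (4 * ?N * (2 / r)))"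
    using r p0_pos by (intro sum.cong refl ennreal_mult[symmetric]) auto
  also have "\<dots> = ennreal (real (card Y) * (4 * ?N * (2 / r)))"
    using r p0_pos by (subst sum_ennreal) auto
  also have "\<dots> \<le> ennreal (?N * (4 * ?N * (2 / r)))"
    using card r p0_pos by (intro ennreal_leI mult_right_mono) auto
  also have "?N * (4 * ?N * (2 / r)) = Ccut / r"
    by (simp add: Ccut_def power2_eq_square)
  finally have "energy E mu h \<le> ennreal (Ccut / r)" .
  moreover have "h z = 0" if "z \<notin> bR x r" for z using that by (simp add: h_def)
  ultimately show ?thesis using h01 h1 by blast
qed

text \<open>\<Phi> may jump, so a prescribed value is met only up to a factor: take the first dyadic
  multiple of a small radius at which T is reached.\<close>

lemma ex_scale:
  assumes "0 < T" shows "\<exists>r>0. T \<le> \<Phi> x r \<and> \<Phi> x r \<le> 4 ^ Suc D * T"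
proof -
  \<comment> \<open>The bound 1 allows comparison with \<open>V x 1\<close>; the other then gives
    \<open>\<Phi> x r0\<close> <= T / 2.\<close>
  define r0 where "r0 = min 1 (T / (2 * V x 1))"
  have r0: "0 < r0" using assms V_pos[of 1 x] by (simp add: r0_def)
  have "\<Phi> x r0 \<le> r0 * V x 1"
    unfolding \<Phi>_def using r0 by (intro mult_left_mono V_mono) (auto simp: r0_def)
  also have "\<dots> \<le> T / (2 * V x 1) * V x 1" using V_nonneg by (intro mult_right_mono) (auto simp: r0_def)
  also have "\<dots> < T" using V_pos[of 1 x] assms by simp
  finally have small: "\<Phi> x r0 < T" .
  define k where "k = (LEAST k. T \<le> \<Phi> x (2 ^ k * r0))"
  have "\<exists>k. T \<le> \<Phi> x (2 ^ k * r0)"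
  proof -
    obtain k where "T / \<Phi> x r0 < 2 ^ k" using real_arch_pow[of 2 "T / \<Phi> x r0"] by auto
    then have "T \<le> 2 ^ k * \<Phi> x r0" using \<Phi>_pos[OF r0, of x] by (simp add: field_simps)
    also have "\<dots> \<le> \<Phi> x (2 ^ k * r0)" using r0 by (intro \<Phi>_scale_ge) auto
    finally show ?thesis by blast
  qed
  then have k: "T \<le> \<Phi> x (2 ^ k * r0)" unfolding k_def by (rule LeastI_ex)
  then obtain j where j: "k = Suc j" using small by (cases k) auto
  then have T: "\<Phi> x (2 ^ j * r0) < T" 
    using not_less_Least[of j "\<lambda>k. T \<le> \<Phi> x (2 ^ k * r0)"] by (simp add: k_def not_le)
  have "\<Phi> x (2 ^ k * r0) = \<Phi> x (2 * (2 ^ j * r0))" by (simp add: j mult.assoc)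
  also have "\<dots> \<le> (2 * 2) ^ Suc D * \<Phi> x (2 ^ j * r0)" using r0 by (intro \<Phi>_scale_le) auto
  also have "\<dots> \<le> (2 * 2) ^ Suc D * T" using T by (intro mult_left_mono) auto
  finally have "\<Phi> x (2 ^ k * r0) \<le> 4 ^ Suc D * T" by simp
  then show ?thesis using k r0 by (intro exI[of _ "2 ^ k * r0"]) auto
qed

lemma ex_exit:
  assumes "finite B" "x \<in> B" shows "\<exists>w z. w \<in> B \<and> z \<notin> B \<and> E w z"
proof -
  obtain y where y: "y \<notin> B" using assms(1) infinite_UNIV by (metis ex_new_if_finite)
  have "E\<^sup>*\<^sup>* x y" using connected by (auto simp: connected_graph_def)
  then show ?thesis using y
    by (induction rule: rtranclp_induct) (use assms(2) in blast)+
qed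

end

subsection \<open>The metric\<close>

lemma powr_less_cancel_base:
  fixes a b c :: real
  assumes "0 < c" "0 \<le> b" "a powr c < b powr c" shows "a < b"
  using powr_mono2[of c b a] assms by (cases "a < b") auto

text \<open>Supplies the distortion function for quasisymmetry: large and small resistance ratios
  obey different exponents.\<close>

lemma homeomorphism_powr_sum:
  fixes K a b :: real
  assumes "0 < K" "0 < a" "0 < b"
  shows "\<exists>\<theta>'. homeomorphism {0..} {0..} (\<lambda>t::real. K * (t powr a + t powr b)) \<theta>'"
proof (rule homeomorphism_into_1d)
  let ?f = "\<lambda>t::real. K * (t powr a + t powr b)"
  show "path_connected {0::real..}" by (intro convex_imp_path_connected convex_real_interval)
  show cont: "continuous_on {0..} ?f"
    using assms by (intro continuous_intros continuous_on_powr') auto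
  have less: "?f s < ?f t" if "0 \<le> s" "s < t" for s t
    using that assms by (intro mult_strict_left_mono add_strict_mono powr_less_mono2) auto
  show "inj_on ?f {0..}"
    using less by (intro linorder_inj_onI) (auto simp: less_le)
  show "?f ` {0..} = {0..}"
  proof (intro antisym subsetI)
    fix y assume "y \<in> ?f ` {0..}"
    then show "y \<in> {0..}" using assms by auto
  next
    fix y :: real assume y: "y \<in> {0..}"
    define T where "T = (y / K) powr (1 / a)"
    have "K * T powr a = y" using y assms by (simp add: T_def powr_powr)
    then have "y \<le> ?f T" using assms by (simp add: distrib_left)
    moreover have "0 \<le> T" by (simp add: T_def)
    moreover have "?f 0 \<le> y" using y by simp
    moreover have "continuous_on {0..T} ?f" using cont by (rule continuous_on_subset) auto
    ultimately obtain t where "0 \<le> t" "?f t = y" using IVT'[of ?f 0 y T] by blast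
    then show "y \<in> ?f ` {0..}" by force
  qed
qed

section \<open>The quasi-metric and its metrization\<close>

context doubling_resistance_graph
begin

text \<open>The two terms are comparable by \<open>\<Phi>_shift\<close>; adding them gives
  symmetry.\<close>

definition q :: "'a \<Rightarrow> 'a \<Rightarrow> real" where "q x y = \<Phi> x (R x y) + \<Phi> y (R x y)"

lemma \<Phi>_nonneg: "0 \<le> r \<Longrightarrow> 0 \<le> \<Phi> x r"
  using V_nonneg by (simp add: \<Phi>_def)

lemma q_ge: "\<Phi> x (R x y) \<le> q x y"
  using \<Phi>_nonneg[OF R_nonneg] by (simp add: q_def)

lemma q_nonneg: "0 \<le> q x y"
  using \<Phi>_nonneg[OF R_nonneg] by (simp add: q_def)

lemma q_refl: "q x x = 0"
  by (simp add: q_def \<Phi>_def)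

lemma q_ge_1: "x \<noteq> y \<Longrightarrow> 1 \<le> q x y"
  using \<Phi>_mono[of "1 / m x" "R x y" x] q_ge[of x y] R_ge[of x y] m_pos[of x]
  by (simp add: \<Phi>_inverse_m less_imp_le)

lemma q_sym: "q x y = q y x"
  by (simp add: q_def R_sym[of x y])

definition Cq :: real where "Cq = 1 + 8 ^ D"

lemma Cq_ge_1: "1 \<le> Cq"
  by (simp add: Cq_def)

lemma q_le: "q x y \<le> Cq * \<Phi> x (R x y)"
proof (cases "x = y")
  case False
  then show ?thesis using \<Phi>_shift[of x y "R x y"] R_pos[of x y] by (simp add: q_def Cq_def algebra_simps)
qed (simp add: q_def \<Phi>_def)

definition Kq :: real where "Kq = Cq * 8 ^ Suc D * 8 ^ D"

lemma Kq_ge_1: "1 \<le> Kq"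
proof -
  have "1 * 1 * 1 \<le> Kq" unfolding Kq_def using Cq_ge_1 by (intro mult_mono one_le_power) auto
  then show ?thesis by simp
qed

text \<open>The longer leg, of resistance r, decides: R x z <= 4 * r, and the polynomial growth of
  \<Phi> absorbs the 4. If that leg starts at y, moving the centre to x costs 8 ^ D.\<close>

lemma q_quasi_triangle: "q x z \<le> Kq * max (q x y) (q y z)"
proof -
  let ?r = "max (R x y) (R y z)"
  show ?thesis
  proof (cases "?r = 0")
    case True
    then have "x = y" "y = z" using R_pos[of x y] R_pos[of y z] R_nonneg[of x y] R_nonneg[of y z]
      by (metis max.cobounded1 max.cobounded2 not_le)+
    then show ?thesis by (simp add: q_refl)
  next
    case False
    then have r: "0 < ?r" using R_nonneg[of x y] by (auto simp: less_le le_max_iff_disj)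
    have shift: "\<Phi> x ?r \<le> 8 ^ D * max (q x y) (q y z)"
    proof (cases "R y z \<le> R x y")
      case True
      have "1 * q x y \<le> 8 ^ D * max (q x y) (q y z)" using q_nonneg by (intro mult_mono) auto
      then show ?thesis using True q_ge[of x y] by (simp add: max_absorb1)
    next
      case False
      then have eq: "?r = R y z" by simp
      have "\<Phi> x ?r \<le> 8 ^ D * \<Phi> y ?r" using r by (intro \<Phi>_shift) (auto simp: R_sym)
      also have "\<dots> \<le> 8 ^ D * max (q x y) (q y z)"
        unfolding eq using q_ge[of y z] by (intro mult_left_mono) (auto simp: le_max_iff_disj)
      finally show ?thesis .
    qed
    have "2 * (R x y + R y z) \<le> 2 * (?r + ?r)" by (intro mult_left_mono add_mono) auto
    then have "R x z \<le> 2 * (?r + ?r)" by (rule order_trans[OF R_quasi_triangle])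
    then have "R x z \<le> 4 * ?r" by simp
    then have "\<Phi> x (R x z) \<le> \<Phi> x (4 * ?r)" by (intro \<Phi>_mono R_nonneg)
    also have "\<dots> \<le> (2 * 4) ^ Suc D * \<Phi> x ?r" using r by (intro \<Phi>_scale_le) auto
    also have "\<dots> \<le> (2 * 4) ^ Suc D * (8 ^ D * max (q x y) (q y z))"
      using shift by (intro mult_left_mono) auto
    finally have "Cq * \<Phi> x (R x z) \<le> Cq * ((2 * 4) ^ Suc D * (8 ^ D * max (q x y) (q y z)))"
      using Cq_ge_1 by (intro mult_left_mono) auto
    then show ?thesis using q_le[of x z] by (simp add: Kq_def mult.assoc)
  qed
qed

text \<open>Two uses of the quasi-triangle inequality cost Kq^2; \<beta> is so large that the power
  1 / \<beta> of this constant is at most 2, as \<open>chain_metric\<close> demands.\<close>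

lemma ex_metric:
  "\<exists>d \<beta>. is_metric d \<and> 2 \<le> \<beta> \<and> (\<forall>x y. d x y powr \<beta> \<le> q x y \<and> q x y \<le> (2 * d x y) powr \<beta>)"
proof -
  obtain k where k: "Kq\<^sup>2 < 2 ^ k" using real_arch_pow[of 2 "Kq\<^sup>2"] by auto
  define \<beta> where "\<beta> = real (k + 2)"
  have b: "2 \<le> \<beta>" by (simp add: \<beta>_def)
  have "(2::real) ^ k \<le> 2 powr \<beta>" unfolding \<beta>_def by (subst powr_realpow) auto
  then have "Kq\<^sup>2 powr (1 / \<beta>) \<le> (2 powr \<beta>) powr (1 / \<beta>)" using k b by (intro powr_mono2) auto
  then have K2: "Kq\<^sup>2 powr (1 / \<beta>) \<le> 2" using b by (simp add: powr_powr)
  define p where "p x y = q x y powr (1 / \<beta>)" for x y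
  have p0: "0 \<le> p x y" for x y by (simp add: p_def)
  have peq: "p x y = 0 \<longleftrightarrow> x = y" for x y
    using q_ge_1[of x y] by (cases "x = y") (auto simp: p_def q_refl)
  have psym: "p x y = p y x" for x y by (simp add: p_def q_sym[of x y])
  have quasi: "p x w \<le> 2 * max (p x y) (max (p y z) (p z w))" for x y z w
  proof -
    let ?M = "max (q x y) (max (q y z) (q z w))"
    have "q y w \<le> Kq * ?M"
      using Kq_ge_1 by (intro order_trans[OF q_quasi_triangle[of y w z]] mult_left_mono) auto
    moreover have "q x y \<le> Kq * ?M"
    proof -
      have "1 * q x y \<le> Kq * ?M" using Kq_ge_1 q_nonneg by (intro mult_mono) auto
      then show ?thesis by simp
    qed
    ultimately have "Kq * max (q x y) (q y w) \<le> Kq * (Kq * ?M)"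
      using Kq_ge_1 by (intro mult_left_mono) auto
    then have "q x w \<le> Kq\<^sup>2 * ?M"
      using q_quasi_triangle[of x w y] by (simp add: power2_eq_square mult.assoc)
    then have "p x w \<le> (Kq\<^sup>2 * ?M) powr (1 / \<beta>)"
      unfolding p_def using b q_nonneg by (intro powr_mono2) auto
    also have "\<dots> = Kq\<^sup>2 powr (1 / \<beta>) * ?M powr (1 / \<beta>)"
      by (rule powr_mult)
    also have "\<dots> \<le> 2 * ?M powr (1 / \<beta>)" using K2 by (intro mult_right_mono) auto
    also have "?M powr (1 / \<beta>) \<le> max (p x y) (max (p y z) (p z w))"
      unfolding p_def by (auto simp: max_def)
    finally show ?thesis by simp
  qed
  let ?d = "chain_metric p"
  note d = chain_metric[of p, OF p0 peq psym quasi]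
  have d0: "0 \<le> ?d x y" for x y using d(1) by (simp add: is_metric_def)
  have pq: "p x y powr \<beta> = q x y" for x y using b q_nonneg by (simp add: p_def powr_powr)
  have "?d x y powr \<beta> \<le> q x y" for x y
    unfolding pq[symmetric] using d(2) d0 b by (intro powr_mono2) auto
  moreover have "q x y \<le> (2 * ?d x y) powr \<beta>" for x y
    unfolding pq[of x y, symmetric] using d(3) p0 b by (intro powr_mono2) auto
  ultimately show ?thesis using d(1) b by blast
qed

end

section \<open>Metric balls versus resistance balls\<close>

locale resistance_quasi_metric = doubling_resistance_graph E mu p0 D
  for E :: "'a \<Rightarrow> 'a \<Rightarrow> bool" and mu p0 D +
  fixes d :: "'a \<Rightarrow> 'a \<Rightarrow> real" and \<beta> :: real
  assumes metric: "is_metric d" and \<beta>_ge_2: "2 \<le> \<beta>"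
    and d_le_q: "d x y powr \<beta> \<le> q x y" and q_le_d: "q x y \<le> (2 * d x y) powr \<beta>"
begin

lemma d_nonneg: "0 \<le> d x y" and d_refl: "d x x = 0"
  using metric by (auto simp: is_metric_def)

lemma d_ge_half: "x \<noteq> y \<Longrightarrow> 1 / 2 \<le> d x y"
proof (rule ccontr)
  assume "x \<noteq> y" "\<not> 1 / 2 \<le> d x y"
  then have "(2 * d x y) powr \<beta> < 1 powr \<beta>" using d_nonneg[of x y] \<beta>_ge_2 by (intro powr_less_mono2) auto
  then show False using q_le_d[of x y] q_ge_1[OF \<open>x \<noteq> y\<close>] by simp
qed

text \<open>\<open>c0\<close> compensates the slack of \<open>ex_scale\<close> and the factor
  \<open>Cq\<close>, so that the resistance ball fits into the metric ball; \<open>A0\<close>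
  enlarges it until it contains the metric ball.\<close>

definition c0 :: real where "c0 = 1 / (Cq * 4 ^ Suc D)"
definition A0 :: real where "A0 = 2 powr \<beta> / c0"

lemma c0_pos: "0 < c0"
  using Cq_ge_1 by (simp add: c0_def)

lemma c0_le_1: "c0 \<le> 1"
proof -
  have "1 * 1 \<le> Cq * 4 ^ Suc D" using Cq_ge_1 by (intro mult_mono one_le_power) auto
  then show ?thesis by (simp add: c0_def)
qed

lemma A0_ge_1: "1 \<le> A0"
proof -
  have "1 \<le> 2 powr \<beta>" using \<beta>_ge_2 by (intro ge_one_powr_ge_zero) auto
  then show ?thesis using c0_pos c0_le_1 by (simp add: A0_def field_simps)
qed

lemma \<Phi>_R_less:
  assumes "d x y < s" shows "\<Phi> x (R x y) < (2 * s) powr \<beta>"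
proof -
  have "(2 * d x y) powr \<beta> < (2 * s) powr \<beta>"
    using assms d_nonneg[of x y] \<beta>_ge_2 by (intro powr_less_mono2) auto
  then show ?thesis using q_ge[of x y] q_le_d[of x y] by linarith
qed

text \<open>The dictionary behind the volume, resistance and heat kernel estimates; both inclusions
  follow by comparing \<open>\<Phi> x (R x y)\<close> with \<open>q x y\<close>.\<close>

lemma ex_radius:
  assumes s: "0 < s"
  shows "\<exists>r>0. bR x r \<subseteq> mball d x s \<and> mball d x s \<subseteq> bR x (A0 * r)
    \<and> c0 * s powr \<beta> \<le> \<Phi> x r \<and> \<Phi> x r \<le> s powr \<beta>"
proof -
  obtain r where r: "0 < r" "c0 * s powr \<beta> \<le> \<Phi> x r" "\<Phi> x r \<le> 4 ^ Suc D * (c0 * s powr \<beta>)"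
    using ex_scale[of "c0 * s powr \<beta>" x] c0_pos s by auto
  have "Cq * \<Phi> x r \<le> Cq * (4 ^ Suc D * (c0 * s powr \<beta>))"
    using r(3) Cq_ge_1 by (intro mult_left_mono) auto
  also have "\<dots> = s powr \<beta>" using Cq_ge_1 by (simp add: c0_def)
  finally have Cr: "Cq * \<Phi> x r \<le> s powr \<beta>" .
  have "y \<in> mball d x s" if "y \<in> bR x r" for y
  proof -
    have "\<Phi> x (R x y) < \<Phi> x r" using that R_nonneg by (intro \<Phi>_strict_mono) (auto simp: mball_def)
    then have "Cq * \<Phi> x (R x y) < Cq * \<Phi> x r" using Cq_ge_1 by simp
    then have "d x y powr \<beta> < s powr \<beta>" using q_le[of x y] d_le_q[of x y] Cr by linarith
    then have "d x y < s" using powr_less_cancel_base[of \<beta> s "d x y"] s \<beta>_ge_2 by simp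
    then show ?thesis by (simp add: mball_def)
  qed
  moreover have "y \<in> bR x (A0 * r)" if "y \<in> mball d x s" for y
  proof -
    have "\<Phi> x (R x y) < (2 * s) powr \<beta>" using that by (intro \<Phi>_R_less) (simp add: mball_def)
    also have "\<dots> = A0 * (c0 * s powr \<beta>)" using s c0_pos by (simp add: A0_def powr_mult)
    also have "\<dots> \<le> A0 * \<Phi> x r" using r(2) A0_ge_1 by (intro mult_left_mono) auto
    also have "\<dots> \<le> \<Phi> x (A0 * r)" using r(1) A0_ge_1 by (intro \<Phi>_scale_ge) auto
    finally have "R x y < A0 * r" by (rule \<Phi>_less_D) (use r(1) A0_ge_1 in simp)
    then show ?thesis by (simp add: mball_def)
  qed
  moreover have "1 * \<Phi> x r \<le> Cq * \<Phi> x r" using Cq_ge_1 \<Phi>_nonneg[of r x] r(1) by (intro mult_right_mono) auto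
  ultimately show ?thesis using r(1,2) Cr by (intro exI[of _ r]) auto
qed

lemma finite_bd: "finite (mball d x s)"
proof (cases "0 < s")
  case True
  then show ?thesis using ex_radius[of s x] finite_bR by (meson finite_subset)
next
  case False
  then have "mball d x s = {}" using d_nonneg[of x] by (auto simp: mball_def not_less intro: order_trans)
  then show ?thesis by simp
qed

definition Vd :: "'a \<Rightarrow> real \<Rightarrow> real" where "Vd x s = (\<Sum>z\<in>mball d x s. m z)"

lemma Vball_d: "Vball E mu d x s = ennreal (Vd x s)"
  by (simp add: Vball_def Vd_def vol_finite finite_bd)

lemma Vd_nonneg: "0 \<le> Vd x s"
  unfolding Vd_def using m_pos by (intro sum_nonneg) (simp add: less_imp_le)

lemma V_le_Vd: "bR x r \<subseteq> mball d x s \<Longrightarrow> V x r \<le> Vd x s"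
  unfolding V_def Vd_def by (intro sum_m_mono finite_bd)

lemma Vd_le_V:
  assumes "mball d x s \<subseteq> bR x (A0 * r)" "0 < r" shows "Vd x s \<le> (2 * A0) ^ D * V x r"
proof -
  have "Vd x s \<le> V x (A0 * r)"
    unfolding V_def Vd_def by (intro sum_m_mono finite_bR assms)
  also have "\<dots> \<le> (2 * A0) ^ D * V x r" using A0_ge_1 assms(2) by (rule V_scale)
  finally show ?thesis .
qed

section \<open>Edge lengths, fitting and quasisymmetry\<close>

definition Cd :: real where "Cd = (Cq * (4 / p0) ^ Suc D) powr (1 / \<beta>)"

lemma Cd_pos: "0 < Cd"
  using Cq_ge_1 p0_pos by (simp add: Cd_def)

text \<open>An edge at x has resistance at most 2 / p0 times 1 / \<open>m x\<close>, a radius where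
  \<Phi> equals 1, so \<open>q\<close> is bounded on edges.\<close>

lemma d_edge_le: "E x y \<Longrightarrow> d x y \<le> Cd"
proof -
  assume xy: "E x y"
  have "p0 \<le> mu x y / m x" by (rule p0_le[OF xy])
  also have "\<dots> \<le> 1" using mu_le_m[OF xy] m_pos[of x] by simp
  finally have p1: "1 \<le> 2 / p0" using p0_pos by simp
  have "\<Phi> x (R x y) \<le> \<Phi> x (2 / p0 * (1 / m x))" by (intro \<Phi>_mono R_nonneg R_edge_le_m xy)
  also have "\<dots> \<le> (2 * (2 / p0)) ^ Suc D * \<Phi> x (1 / m x)"
    using p1 m_pos[of x] by (intro \<Phi>_scale_le) auto
  finally have "\<Phi> x (R x y) \<le> (4 / p0) ^ Suc D" by (simp add: \<Phi>_inverse_m)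
  then have "Cq * \<Phi> x (R x y) \<le> Cq * (4 / p0) ^ Suc D" using Cq_ge_1 by (intro mult_left_mono) auto
  then have "d x y powr \<beta> \<le> Cq * (4 / p0) ^ Suc D" using q_le[of x y] d_le_q[of x y] by linarith
  then have "(d x y powr \<beta>) powr (1 / \<beta>) \<le> Cd" unfolding Cd_def using \<beta>_ge_2 by (intro powr_mono2) auto
  then show ?thesis using \<beta>_ge_2 d_nonneg by (simp add: powr_powr)
qed

lemma edge_length: "\<exists>c1>0. \<exists>c2>0. \<forall>x y. E x y \<longrightarrow> c1 \<le> d x y \<and> d x y \<le> c2"
  using d_ge_half d_edge_le Cd_pos E_neq by (intro exI[of _ "1/2"] exI[of _ Cd] conjI) auto

text \<open>Distinct points are at least 1 / 2 apart while edges have length at most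
  \<open>Cd\<close>. For the second condition s is so large that \<epsilon> * s = \<open>Cd\<close>,
  and a path to a vertex outside the ball is stopped at its first exit.\<close>

lemma fits: "fits d E"
  unfolding fits_def
proof (intro conjI allI impI)
  show "\<exists>C>0. \<forall>x y z. E x y \<and> x \<noteq> z \<longrightarrow> d x y \<le> C * d x z"
  proof (intro exI[of _ "2 * Cd"] conjI allI impI)
    fix x y z assume *: "E x y \<and> x \<noteq> z"
    then have "2 * Cd * (1 / 2) \<le> 2 * Cd * d x z" using d_ge_half[of x z] Cd_pos by (intro mult_left_mono) auto
    then show "d x y \<le> 2 * Cd * d x z" using d_edge_le[of x y] * by simp
  qed (simp add: Cd_pos)
next
  fix \<epsilon> :: real assume e: "0 < \<epsilon>"
  define s where "s = Cd / \<epsilon>"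
  have s: "0 < s" "\<epsilon> * s = Cd" using e Cd_pos by (auto simp: s_def)
  fix x0 :: 'a
  obtain y where y: "y \<notin> mball d x0 s" using finite_bd[of x0 s] infinite_UNIV by (metis ex_new_if_finite)
  have "E\<^sup>*\<^sup>* x0 y" using connected by (auto simp: connected_graph_def)
  then obtain N where "(E ^^ N) x0 y" using rtranclp_imp_relpowp by metis
  then obtain xs where xs: "xs 0 = x0" "xs N = y" "\<And>i. i < N \<Longrightarrow> E (xs i) (xs (Suc i))"
    by (auto simp: relpowp_fun_conv)
  define n where "n = (LEAST n. xs n \<notin> mball d x0 s)"
  have n: "xs n \<notin> mball d x0 s" unfolding n_def by (rule LeastI[of _ N]) (simp add: y xs)
  have nN: "n \<le> N" unfolding n_def by (rule Least_le) (simp add: y xs)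
  have less: "xs i \<in> mball d x0 s" if "i < n" for i
    using not_less_Least[of i "\<lambda>n. xs n \<notin> mball d x0 s"] that by (simp add: n_def)
  have "x0 \<in> mball d x0 s" using s by (simp add: mball_def d_refl)
  then have "n \<noteq> 0" using n xs(1) by metis
  moreover have "E (xs i) (xs (i - 1)) \<and> d (xs i) (xs (i - 1)) \<le> \<epsilon> * s" if "i \<in> {1..n}" for i
  proof -
    have "E (xs (i - 1)) (xs i)" using xs(3)[of "i - 1"] that nN by (cases i) auto
    then show ?thesis using E_sym d_edge_le s(2) by auto
  qed
  ultimately show "\<exists>s>0. \<exists>n\<ge>1. \<exists>xs :: nat \<Rightarrow> 'a.
        (\<forall>i<n. xs i \<in> mball d (xs 0) s) \<and> xs n \<notin> mball d (xs 0) s \<and>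
        (\<forall>i\<in>{1..n}. E (xs i) (xs (i-1)) \<and> d (xs i) (xs (i-1)) \<le> \<epsilon> * s)"
    using s(1) n less xs(1) by (intro exI[of _ s] conjI exI[of _ n] exI[of _ xs]) auto
qed

text \<open>With t the ratio of distances, the ratio of \<Phi> values is at most a multiple of
  \<open>t powr \<beta>\<close>. A resistance ratio u >= 1 obeys the same bound since \<Phi> grows
  at least linearly; for u < 1 polynomial growth bounds u ^ Suc D instead, whence the exponent
  \<open>b\<close>.\<close>

lemma quasisymmetric: "quasisymmetric d R"
proof -
  define K where "K = 2 ^ Suc D * Cq * 2 powr \<beta>"
  have "1 * 1 * 1 \<le> K" unfolding K_def
    using Cq_ge_1 \<beta>_ge_2 by (intro mult_mono one_le_power ge_one_powr_ge_zero) auto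
  then have K: "1 \<le> K" by simp
  define b where "b = \<beta> / real (Suc D)"
  have b: "0 < b" using \<beta>_ge_2 by (simp add: b_def)
  have "R x y / R x z \<le> K * ((d x y / d x z) powr \<beta> + (d x y / d x z) powr b)" if xz: "x \<noteq> z" for x y z
  proof (cases "x = y")
    case True
    then show ?thesis using K by simp
  next
    case False
    let ?u = "R x y / R x z" and ?t = "d x y / d x z"
    have R: "0 < R x y" "0 < R x z" using xz False by (auto intro: R_pos)
    have dz: "0 < d x z" using d_ge_half[OF xz] by linarith
    have "\<Phi> x (R x y) \<le> (2 * d x y) powr \<beta>" using q_ge[of x y] q_le_d[of x y] by linarith
    also have "\<dots> = 2 powr \<beta> * ?t powr \<beta> * d x z powr \<beta>"
      using dz d_nonneg[of x y] by (simp add: powr_mult powr_divide)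
    also have "\<dots> \<le> 2 powr \<beta> * ?t powr \<beta> * (Cq * \<Phi> x (R x z))"
      using d_le_q[of x z] q_le[of x z] by (intro mult_left_mono) auto
    finally have \<Phi>: "\<Phi> x (R x y) \<le> Cq * 2 powr \<beta> * ?t powr \<beta> * \<Phi> x (R x z)" by (simp add: mult_ac)
    have pos: "0 < \<Phi> x (R x z)" "0 < \<Phi> x (R x y)" using R by (auto intro: \<Phi>_pos)
    show ?thesis
    proof (cases "1 \<le> ?u")
      case True
      have "?u * \<Phi> x (R x z) \<le> \<Phi> x (?u * R x z)" using True R by (intro \<Phi>_scale_ge) auto
      then have "?u * \<Phi> x (R x z) \<le> Cq * 2 powr \<beta> * ?t powr \<beta> * \<Phi> x (R x z)" using \<Phi> R by simp
      then have "?u \<le> Cq * 2 powr \<beta> * ?t powr \<beta>" using pos by (simp only: mult_le_cancel_right_pos)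
      also have "\<dots> \<le> K * ?t powr \<beta>"
      proof (rule mult_right_mono)
        have "1 * (Cq * 2 powr \<beta>) \<le> 2 ^ Suc D * (Cq * 2 powr \<beta>)"
          using Cq_ge_1 by (intro mult_right_mono one_le_power) auto
        then show "Cq * 2 powr \<beta> \<le> K" by (simp add: K_def mult.assoc)
      qed simp
      also have "\<dots> \<le> K * (?t powr \<beta> + ?t powr b)" using K by (intro mult_left_mono) auto
      finally show ?thesis .
    next
      case False
      have u0: "0 < ?u" using R by simp
      have "\<Phi> x (1 / ?u * R x y) \<le> (2 * (1 / ?u)) ^ Suc D * \<Phi> x (R x y)"
        using False R by (intro \<Phi>_scale_le) auto
      moreover have "1 / ?u * R x y = R x z" using R by simp
      ultimately have "\<Phi> x (R x z) \<le> (2 * (1 / ?u)) ^ Suc D * \<Phi> x (R x y)" by simp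
      also have "\<dots> = 2 ^ Suc D * \<Phi> x (R x y) / ?u ^ Suc D" by (simp add: power_divide power_mult_distrib)
      finally have "?u ^ Suc D * \<Phi> x (R x z) \<le> 2 ^ Suc D * \<Phi> x (R x y)"
        using u0 by (simp only: pos_le_divide_eq zero_less_power mult.commute)
      also have "\<dots> \<le> 2 ^ Suc D * (Cq * 2 powr \<beta> * ?t powr \<beta> * \<Phi> x (R x z))"
        using \<Phi> by (intro mult_left_mono) auto
      also have "\<dots> = K * ?t powr \<beta> * \<Phi> x (R x z)" by (simp add: K_def mult_ac)
      finally have "?u ^ Suc D \<le> K * ?t powr \<beta>" using pos by (simp only: mult_le_cancel_right_pos)
      then have "?u powr real (Suc D) \<le> K * ?t powr \<beta>" by (simp only: powr_realpow[OF u0])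
      then have "(?u powr real (Suc D)) powr (1 / real (Suc D)) \<le> (K * ?t powr \<beta>) powr (1 / real (Suc D))"
        by (intro powr_mono2) auto
      moreover have "(?u powr real (Suc D)) powr (1 / real (Suc D)) = ?u"
        using R by (simp only: powr_powr) simp
      moreover have "(K * ?t powr \<beta>) powr (1 / real (Suc D)) = K powr (1 / real (Suc D)) * ?t powr b"
        using K by (simp add: powr_powr powr_mult b_def del: of_nat_Suc)
      ultimately have "?u \<le> K powr (1 / real (Suc D)) * ?t powr b" by (simp only:)
      also have "\<dots> \<le> K powr 1 * ?t powr b" using K by (intro mult_right_mono powr_mono) auto
      also have "\<dots> \<le> K * (?t powr \<beta> + ?t powr b)" using K by (simp add: mult_left_mono)
      finally show ?thesis .
    qed
  qed
  then show ?thesis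
    unfolding quasisymmetric_def using homeomorphism_powr_sum[of K \<beta> b] K b \<beta>_ge_2
    by (smt (verit))
qed

section \<open>Resistance, volume and heat kernel estimates in the metric\<close>

lemma ex_near_point:
  assumes "rmin d x < s" shows "\<exists>y. y \<noteq> x \<and> d x y < s"
proof -
  obtain z where "z \<noteq> x" using ex_nb[of x] E_neq by metis
  then have "{d x y | y. y \<noteq> x} \<noteq> {}" by blast
  then show ?thesis using cInf_lessD[of "{d x y | y. y \<noteq> x}" s] assms by (auto simp: rmin_def)
qed

text \<open>The cutoff for the resistance ball inside the metric ball is the test function; it
  equals 1 on the smaller metric ball once that fits into \<open>bR x (r / 32)\<close>.\<close>

lemma ARL:
  "\<exists>lam>0. \<exists>C>0. \<forall>x s. s > rmin d x \<longrightarrow>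
     eff_res E mu (mball d x (lam * s)) (- mball d x s) * Vball E mu d x s \<ge> ennreal (C * s powr \<beta>)"
proof -
  \<comment> \<open>Shrinking the radius by 32 costs 64 ^ Suc D in \<Phi>; \<open>lam\<close> then
    solves \<open>(2 * lam) powr \<beta> = c\<close>, which matches
    \<open>\<Phi>_R_less\<close>.\<close>
  define c where "c = c0 / 64 ^ Suc D"
  have c: "0 < c" using c0_pos by (simp add: c_def)
  define lam where "lam = c powr (1 / \<beta>) / 2"
  have lam: "0 < lam" "(2 * lam) powr \<beta> = c" using c \<beta>_ge_2 by (auto simp: lam_def powr_powr)
  have "ennreal (c0 / Ccut * s powr \<beta>)
      \<le> eff_res E mu (mball d x (lam * s)) (- mball d x s) * Vball E mu d x s" if "rmin d x < s" for x s
  proof -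
    have s: "0 < s" using ex_near_point[OF that] d_nonneg by (meson le_less_trans)
    obtain r where r: "0 < r" "bR x r \<subseteq> mball d x s" "c0 * s powr \<beta> \<le> \<Phi> x r"
      using ex_radius[OF s, of x] by blast
    have r32: "c * s powr \<beta> \<le> \<Phi> x (r / 32)"
    proof -
      have "\<Phi> x (32 * (r / 32)) \<le> (2 * 32) ^ Suc D * \<Phi> x (r / 32)" using r by (intro \<Phi>_scale_le) auto
      then have "c0 * s powr \<beta> \<le> 64 ^ Suc D * \<Phi> x (r / 32)" using r(3) by simp
      then show ?thesis by (simp add: c_def field_simps)
    qed
    have sub: "mball d x (lam * s) \<subseteq> bR x (r / 32)"
    proof
      fix y assume "y \<in> mball d x (lam * s)"
      then have "\<Phi> x (R x y) < (2 * (lam * s)) powr \<beta>" by (intro \<Phi>_R_less) (simp add: mball_def)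
      also have "\<dots> = (2 * lam) powr \<beta> * s powr \<beta>"
        using lam(1) s by (simp add: powr_mult mult.assoc)
      also have "\<dots> \<le> \<Phi> x (r / 32)" using r32 lam(2) by simp
      finally have "R x y < r / 32" by (rule \<Phi>_less_D) (use r(1) in simp)
      then show "y \<in> bR x (r / 32)" by (simp add: mball_def)
    qed
    obtain f where f: "\<And>z. z \<in> bR x (r / 32) \<Longrightarrow> f z = 1" "\<And>z. z \<notin> bR x r \<Longrightarrow> f z = 0"
      "energy E mu f \<le> ennreal (Ccut / r)" using ex_cutoff[OF r(1), of x] by blast
    have "ennreal (1 / (Ccut / r)) \<le> eff_res E mu (mball d x (lam * s)) (- mball d x s)"
      using f sub r Ccut_ge_1 by (intro eff_res_ge[of _ f]) auto
    then have "ennreal (r / Ccut) * ennreal (Vd x s)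
        \<le> eff_res E mu (mball d x (lam * s)) (- mball d x s) * Vball E mu d x s"
      unfolding Vball_d by (intro mult_right_mono) auto
    moreover have "c0 / Ccut * s powr \<beta> \<le> r / Ccut * Vd x s"
    proof -
      have "c0 * s powr \<beta> \<le> r * Vd x s"
        using r(3) V_le_Vd[OF r(2)] r(1) unfolding \<Phi>_def by (meson mult_left_mono order_trans less_imp_le)
      then show ?thesis using Ccut_ge_1 by (simp add: field_simps)
    qed
    ultimately show ?thesis using r(1) Ccut_ge_1 Vd_nonneg[of x s]
      by (simp add: ennreal_mult[symmetric] order_trans[OF ennreal_leI])
  qed
  moreover have "0 < c0 / Ccut" using c0_pos Ccut_ge_1 by simp
  ultimately show ?thesis using lam(1) by blast
qed

text \<open>Grounding a single vertex outside the ball instead of the whole complement only raises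
  the resistance; choosing it just across an exit edge keeps that resistance of the order of the
  radius.\<close>

lemma BRU:
  "\<exists>C'>0. \<forall>x s. s > rmin d x \<longrightarrow>
     eff_res E mu {x} (- mball d x s) * Vball E mu d x s \<le> ennreal (C' * s powr \<beta>)"
proof -
  define C where "C = (2 + 4 / p0) * (2 * A0) ^ Suc D"
  have C: "0 < C" using p0_pos A0_ge_1 by (simp add: C_def add_pos_pos)
  have "eff_res E mu {x} (- mball d x s) * Vball E mu d x s \<le> ennreal (C * s powr \<beta>)"
    if "rmin d x < s" for x s
  proof -
    have "\<exists>y. y \<noteq> x \<and> d x y < s" by (rule ex_near_point[OF that])
    then obtain y where y: "y \<noteq> x" "d x y < s" by blast
    have s: "0 < s" using y d_nonneg by (meson le_less_trans)
    obtain r where r: "0 < r" "mball d x s \<subseteq> bR x (A0 * r)" "\<Phi> x r \<le> s powr \<beta>"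
      using ex_radius[OF s, of x] by blast
    have Ar: "0 < A0 * r" using r(1) A0_ge_1 by simp
    have "R x y < A0 * r" using r(2) y(2) by (auto simp: mball_def)
    \<comment> \<open>The second vertex y, provided by \<open>rmin d x < s\<close>, puts the radius
      above the single-vertex scale, as \<open>R_exit_le\<close> requires.\<close>
    then have m: "1 / m x \<le> A0 * r" using R_ge[of x y] y(1) by simp
    have "x \<in> bR x (A0 * r)" using Ar by (simp add: mball_def)
    then obtain w z where wz: "w \<in> bR x (A0 * r)" "z \<notin> bR x (A0 * r)" "E w z"
      using ex_exit[OF finite_bR] by blast
    have Rz: "R x z \<le> (2 + 4 / p0) * (A0 * r)"
      using R_exit_le[OF m _ wz(3)] wz(1) by (simp add: mball_def)
    have "eff_res E mu {x} (- mball d x s) \<le> eff_res E mu {x} {z}"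
      using r(2) wz(2) by (intro eff_res_antimono) auto
    then have "eff_res E mu {x} (- mball d x s) * Vball E mu d x s \<le> ennreal (R x z) * ennreal (Vd x s)"
      unfolding Vball_d eff_res_points by (rule mult_right_mono) simp
    also have "\<dots> = ennreal (R x z * Vd x s)" using R_nonneg Vd_nonneg by (simp add: ennreal_mult)
    also have "R x z * Vd x s \<le> C * s powr \<beta>"
    proof -
      have "Vd x s \<le> V x (A0 * r)" unfolding V_def Vd_def by (intro sum_m_mono finite_bR r)
      then have "R x z * Vd x s \<le> (2 + 4 / p0) * (A0 * r) * V x (A0 * r)"
        using Rz Ar p0_pos by (intro mult_mono Vd_nonneg) auto
      also have "\<dots> = (2 + 4 / p0) * \<Phi> x (A0 * r)" by (simp add: \<Phi>_def)
      also have "\<dots> \<le> (2 + 4 / p0) * ((2 * A0) ^ Suc D * \<Phi> x r)"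
        using \<Phi>_scale_le[OF A0_ge_1 r(1)] p0_pos by (intro mult_left_mono) auto
      also have "\<dots> = C * \<Phi> x r" by (simp add: C_def)
      also have "\<dots> \<le> C * s powr \<beta>" using r(3) C by (intro mult_left_mono) auto
      finally show ?thesis .
    qed
    then have "ennreal (R x z * Vd x s) \<le> ennreal (C * s powr \<beta>)" by (rule ennreal_leI)
    finally show ?thesis .
  qed
  then show ?thesis using C by blast
qed

definition \<alpha> :: real where "\<alpha> = \<beta> * real D / real (Suc D)"

lemma \<alpha>_bounds: "1 \<le> \<alpha>" "\<alpha> < \<beta>"
proof -
  have "real (Suc D) \<le> 2 * real D" using D_ge_1 by simp
  also have "\<dots> \<le> \<beta> * real D" using \<beta>_ge_2 by (intro mult_right_mono) auto
  finally have "real (Suc D) \<le> \<beta> * real D" .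
  then show "1 \<le> \<alpha>" by (simp add: \<alpha>_def)
  show "\<alpha> < \<beta>" using \<beta>_ge_2 by (simp add: \<alpha>_def field_simps)
qed

text \<open>With \<open>W\<close> the volume ratio and \<open>u\<close> the ratio of the resistance radii, \<open>u * W\<close> is comparable to
  \<open>(s / t) powr \<beta>\<close> and \<open>W \<lesssim> u ^ D\<close>, whence \<open>W ^ Suc D \<lesssim> (u * W) ^ D\<close>.\<close>

lemma VG:
  "\<exists>C''>0. \<forall>x s t. 0 < t \<and> t < s \<longrightarrow>
     Vball E mu d x s \<le> ennreal (C'' * (s/t) powr \<alpha>) * Vball E mu d x t"
proof -
  define C where "C = (2 * A0) ^ D * (2 / c0) powr (real D / real (Suc D))"
  have C: "0 < C" using A0_ge_1 c0_pos by (simp add: C_def)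
  have "Vd x s \<le> C * (s / t) powr \<alpha> * Vd x t" if ts: "0 < t" "t < s" for x s t
  proof -
    have s: "0 < s" using ts by simp
    obtain r where r: "0 < r" "mball d x s \<subseteq> bR x (A0 * r)" "\<Phi> x r \<le> s powr \<beta>"
      using ex_radius[OF s, of x] by blast
    obtain r' where r': "0 < r'" "bR x r' \<subseteq> mball d x t" "c0 * t powr \<beta> \<le> \<Phi> x r'"
      using ex_radius[OF ts(1), of x] by blast
    define W where "W = V x r / V x r'"
    define u where "u = r / r'"
    have W0: "0 < W" using r(1) r'(1) V_pos by (simp add: W_def)
    have u0: "0 < u" using r(1) r'(1) by (simp add: u_def)
    let ?B = "2 / c0 * (s / t) powr \<beta>"
    have st1: "1 \<le> (s / t) powr \<beta>" using ts \<beta>_ge_2 by (intro ge_one_powr_ge_zero) auto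
    have uW: "2 * (u * W) \<le> ?B"
    proof -
      have "u * W = \<Phi> x r / \<Phi> x r'" by (simp add: u_def W_def \<Phi>_def)
      also have "\<dots> \<le> s powr \<beta> / (c0 * t powr \<beta>)"
        using r(3) r'(3) c0_pos ts \<Phi>_nonneg[of r x] r(1) by (intro frac_le) auto
      also have "\<dots> = 1 / c0 * (s / t) powr \<beta>" using s ts by (simp add: powr_divide)
      finally show ?thesis by simp
    qed
    have "W ^ Suc D \<le> ?B ^ D"
    \<comment> \<open>Radii match s and t only up to constants, so this order can occur although t <
      s; then W <= 1.\<close>
    proof (cases "r \<le> r'")
      case True
      then have "W \<le> 1" using V_mono[OF True, of x] V_pos[OF r'(1), of x] by (simp add: W_def)
      then have "W ^ Suc D \<le> 1" using W0 by (intro power_le_one) auto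
      moreover have "1 * 1 \<le> ?B" using st1 c0_pos c0_le_1 by (intro mult_mono) auto
      ultimately show ?thesis using one_le_power[of ?B D] by linarith
    next
      case False
      have "V x (u * r') \<le> (2 * u) ^ D * V x r'" using False r' by (intro V_scale) (auto simp: u_def)
      then have "W \<le> (2 * u) ^ D" using r' V_pos[OF r'(1), of x] by (simp add: W_def u_def field_simps)
      then have "W ^ Suc D \<le> (2 * u) ^ D * W ^ D" using W0 by (simp add: mult_right_mono)
      also have "\<dots> = (2 * (u * W)) ^ D" by (simp add: power_mult_distrib)
      also have "\<dots> \<le> ?B ^ D" using uW u0 W0 by (intro power_mono) auto
      finally show ?thesis .
    qed
    then have "(W powr real (Suc D)) powr (1 / real (Suc D)) \<le> (?B powr real D) powr (1 / real (Suc D))"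
      using W0 c0_pos s ts by (intro powr_mono2) (auto simp: powr_realpow simp del: of_nat_Suc)
    then have "W \<le> ?B powr (real D / real (Suc D))"
      using W0 by (simp add: powr_powr del: of_nat_Suc)
    also have "\<dots> = (2 / c0) powr (real D / real (Suc D)) * (s / t) powr \<alpha>"
      using c0_pos by (subst powr_mult) (auto simp: powr_powr \<alpha>_def simp del: of_nat_Suc)
    finally have W: "W \<le> (2 / c0) powr (real D / real (Suc D)) * (s / t) powr \<alpha>" .
    have "Vd x s \<le> (2 * A0) ^ D * V x r" by (rule Vd_le_V[OF r(2,1)])
    also have "\<dots> = (2 * A0) ^ D * (W * V x r')" using V_pos[OF r'(1), of x] by (simp add: W_def)
    also have "\<dots> \<le> (2 * A0) ^ D * ((2 / c0) powr (real D / real (Suc D)) * (s / t) powr \<alpha> * Vd x t)"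
      using W V_le_Vd[OF r'(2)] V_nonneg A0_ge_1 by (intro mult_left_mono mult_mono) auto
    finally show ?thesis by (simp add: C_def mult.assoc)
  qed
  then show ?thesis using C Vd_nonneg
    by (intro exI[of _ C]) (auto simp: Vball_d ennreal_mult[symmetric] intro!: ennreal_leI)
qed

text \<open>With n of the order of \<open>\<Phi> x r\<close>, the Green function at x is at most of
  order r. Dividing by n gives the upper bound; a cutoff on a large multiple of r gives the lower
  one.\<close>

lemma DHK:
  "\<exists>c1>0. \<exists>c2>0. \<forall>x. \<forall>n::nat. n \<ge> 1 \<longrightarrow>
     ennreal c1 \<le> ennreal (hk E mu (2 * n) x x) * Vball E mu d x (real n powr (1/\<beta>)) \<and>
     ennreal (hk E mu (2 * n) x x) * Vball E mu d x (real n powr (1/\<beta>)) \<le> ennreal c2"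
proof -
  define c1 where "c1 = 1 / (4 * (24 * Ccut / c0) ^ D)"
  define c2 where "c2 = 6 / c0 * (2 * A0) ^ D"
  have pos: "0 < c1" "0 < c2" using c0_pos A0_ge_1 Ccut_ge_1 by (auto simp: c1_def c2_def)
  have "c1 \<le> hk E mu (2 * n) x x * Vd x (real n powr (1/\<beta>))"
    "hk E mu (2 * n) x x * Vd x (real n powr (1/\<beta>)) \<le> c2" if n: "1 \<le> n" for x and n :: nat
  proof -
    define s where "s = real n powr (1/\<beta>)"
    let ?h = "hk E mu (2 * n) x x"
    have s: "0 < s" "s powr \<beta> = real n" using n \<beta>_ge_2 by (auto simp: s_def powr_powr)
    obtain r where r: "0 < r" "bR x r \<subseteq> mball d x s" "mball d x s \<subseteq> bR x (A0 * r)"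
      "c0 * real n \<le> \<Phi> x r" "\<Phi> x r \<le> real n"
      using ex_radius[OF s(1), of x] s(2) by auto
    \<comment> \<open>Enlarging the radius by a / c0 lifts \<Phi> above k; a = 2 serves the upper
      bound, a = 1 the lower.\<close>
    have green: "green k x x \<le> 3 * (a / c0 * r)" if "real k \<le> a * real n" "1 \<le> a" for k a
    proof -
      have ac: "1 \<le> a / c0" using that(2) c0_le_1 c0_pos by (simp add: field_simps)
      have "real k \<le> a / c0 * (c0 * real n)" using that(1) c0_pos by simp
      also have "\<dots> \<le> a / c0 * \<Phi> x r" using r(4) ac by (intro mult_left_mono) auto
      also have "\<dots> \<le> \<Phi> x (a / c0 * r)" using ac r(1) by (intro \<Phi>_scale_ge) auto
      finally have "real k \<le> a / c0 * r * (\<Sum>z\<in>bR x (a / c0 * r). m z)" by (simp add: \<Phi>_def V_def)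
      moreover have "0 < a / c0 * r" using ac r(1) by (intro mult_pos_pos) linarith+
      ultimately show ?thesis by (intro green_diag_le finite_bR)
    qed
    show "?h * Vd x (real n powr (1/\<beta>)) \<le> c2"
    proof -
      have "real n * ?h \<le> 6 / c0 * r"
        using hk_diag_le_green[of n x] green[of "2 * n" 2] by simp
      then have "real n * ?h * Vd x s \<le> 6 / c0 * r * ((2 * A0) ^ D * V x r)"
        by (rule mult_mono[OF _ Vd_le_V[OF r(3,1)] _ Vd_nonneg]) (use r(1) c0_pos in auto)
      also have "\<dots> = c2 * \<Phi> x r" by (simp add: c2_def \<Phi>_def)
      also have "\<dots> \<le> c2 * real n" using r(5) pos by (intro mult_left_mono) auto
      finally have "real n * (?h * Vd x s) \<le> real n * c2" by (simp add: mult_ac)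
      then show ?thesis using n by (simp add: s_def)
    qed
    show "c1 \<le> ?h * Vd x (real n powr (1/\<beta>))"
    proof -
      \<comment> \<open>Makes the cutoff energy \<open>Ccut / (k * r)\<close> times the Green bound
        3 * r / c0 equal to 1 / 4; 2 * k is the base of the power in \<open>c1\<close>.\<close>
      define k where "k = 12 * Ccut / c0"
      have k: "1 \<le> k" using Ccut_ge_1 c0_pos c0_le_1 by (simp add: k_def field_simps)
      have kr: "0 < k * r" using k r(1) by simp
      obtain f where f: "\<And>z. 0 \<le> f z \<and> f z \<le> 1" "\<And>z. z \<in> bR x (k * r / 32) \<Longrightarrow> f z = 1"
        "\<And>z. z \<notin> bR x (k * r) \<Longrightarrow> f z = 0" "energy E mu f \<le> ennreal (Ccut / (k * r))"
        using ex_cutoff[OF kr, of x] by blast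
      have "Ccut / (k * r) * green n x x \<le> Ccut / (k * r) * (3 * (1 / c0 * r))"
        using green[of n 1] kr Ccut_ge_1 by (intro mult_left_mono) auto
      also have "\<dots> = 1 / 4" using r(1) c0_pos Ccut_ge_1 by (simp add: k_def)
      finally have "1 / 4 \<le> ?h * (\<Sum>z\<in>bR x (k * r). m z)"
        using f kr Ccut_ge_1 by (intro hk_diag_lower[where f = f and e = "Ccut / (k * r)"] finite_bR)
          (auto simp: mball_def abs_le_iff intro: order_trans[of _ 0])
      also have "\<dots> \<le> ?h * ((2 * k) ^ D * Vd x s)"
      proof (intro mult_left_mono hk_nonneg)
        have "V x (k * r) \<le> (2 * k) ^ D * V x r" by (rule V_scale[OF k r(1)])
        also have "\<dots> \<le> (2 * k) ^ D * Vd x s" using V_le_Vd[OF r(2)] k by (intro mult_left_mono) auto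
        finally show "(\<Sum>z\<in>bR x (k * r). m z) \<le> (2 * k) ^ D * Vd x s" by (simp add: V_def)
      qed
      finally have "1 / 4 \<le> (2 * k) ^ D * (?h * Vd x s)" by (simp add: mult_ac)
      moreover have "0 < (2 * k) ^ D" "c1 = 1 / (4 * (2 * k) ^ D)" using k by (auto simp: c1_def k_def)
      ultimately show ?thesis unfolding s_def[symmetric] by (simp add: field_simps)
    qed
  qed
  then show ?thesis using pos Vd_nonneg hk_nonneg
    by (intro exI[of _ c1] exI[of _ c2]) (auto simp: Vball_d ennreal_mult[symmetric] intro!: ennreal_leI)
qed

end

section \<open>Choice of the growth exponent and assembly\<close>

theorem theorem4p3:
  fixes E :: "'a \<Rightarrow> 'a \<Rightarrow> bool" and mu :: "'a \<Rightarrow> 'a \<Rightarrow> real"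
  assumes "countable (UNIV :: 'a set)" and "infinite (UNIV :: 'a set)"
    and "simple_graph E" and "connected_graph E" and "bounded_degree E"
    and "conductance E mu"
    and "cond_p0 E mu"
    and "VD E mu (res_metric E mu)"
    and "\<forall>M::real. \<exists>x y. res_metric E mu x y > M"
    and "\<forall>x s. s > 0 \<longrightarrow> Vball E mu (res_metric E mu) x s < \<infinity>"
  shows "\<exists>d :: 'a \<Rightarrow> 'a \<Rightarrow> real. \<exists>\<alpha> \<beta> :: real.
     is_metric d \<and> fits d E \<and> quasisymmetric d (res_metric E mu) \<and>
     (\<exists>c1>0. \<exists>c2>0. \<forall>x y. E x y \<longrightarrow> c1 \<le> d x y \<and> d x y \<le> c2) \<and>
     1 \<le> \<alpha> \<and> \<alpha> < \<beta> \<and>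
     \<comment> \<open>DHK(beta)\<close>
     (\<exists>c1>0. \<exists>c2>0. \<forall>x. \<forall>n::nat. n \<ge> 1 \<longrightarrow>
        ennreal c1 \<le> ennreal (hk E mu (2 * n) x x) * Vball E mu d x (real n powr (1/\<beta>)) \<and>
        ennreal (hk E mu (2 * n) x x) * Vball E mu d x (real n powr (1/\<beta>)) \<le> ennreal c2) \<and>
     \<comment> \<open>ARL(beta)\<close>
     (\<exists>lam>0. \<exists>C>0. \<forall>x s. s > rmin d x \<longrightarrow>
        eff_res E mu (mball d x (lam * s)) (- mball d x s) * Vball E mu d x s \<ge> ennreal (C * s powr \<beta>)) \<and>
     \<comment> \<open>BRU(beta)\<close>
     (\<exists>C'>0. \<forall>x s. s > rmin d x \<longrightarrow>
        eff_res E mu {x} (- mball d x s) * Vball E mu d x s \<le> ennreal (C' * s powr \<beta>)) \<and>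
     \<comment> \<open>VG(alpha)\<close>
     (\<exists>C''>0. \<forall>x s t. 0 < t \<and> t < s \<longrightarrow>
        Vball E mu d x s \<le> ennreal (C'' * (s/t) powr \<alpha>) * Vball E mu d x t)"
proof -
  obtain p0 where p0: "0 < p0" "\<And>x y. E x y \<Longrightarrow> p0 \<le> mu x y / mu_v E mu x"
    using assms(7) by (auto simp: cond_p0_def)
  obtain C where C: "0 < C" "\<And>x s. 0 < s \<Longrightarrow> Vball E mu (res_metric E mu) x (2 * s)
      \<le> ennreal C * Vball E mu (res_metric E mu) x s"
    using assms(8) by (auto simp: VD_def)
  obtain k where k: "C < 2 ^ k" using real_arch_pow[of 2 C] by auto
  \<comment> \<open>\<open>Suc k\<close> rather than \<open>k\<close> guarantees an exponent of at
    least 1.\<close>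
  interpret doubling_resistance_graph E mu p0 "Suc k"
  proof
    show "finite {y. E x y}" for x using assms(5) by (auto simp: bounded_degree_def)
    show "Vball E mu (res_metric E mu) x (2 * s)
      \<le> ennreal (2 ^ Suc k) * Vball E mu (res_metric E mu) x s" if "0 < s" for x s
    proof -
      have "(2::real) ^ k \<le> 2 ^ Suc k" by simp
      then have "C \<le> 2 ^ Suc k" using k by linarith
      then have "ennreal C * Vball E mu (res_metric E mu) x s
          \<le> ennreal (2 ^ Suc k) * Vball E mu (res_metric E mu) x s"
        by (intro mult_right_mono ennreal_leI) auto
      then show ?thesis using C(2)[OF that, of x] by (rule order_trans[rotated])
    qed
  qed (use assms p0 in auto)
  obtain d \<beta> where d: "is_metric d" "2 \<le> \<beta>" "\<And>x y. d x y powr \<beta> \<le> q x y"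
    "\<And>x y. q x y \<le> (2 * d x y) powr \<beta>"
    using ex_metric by blast
  interpret resistance_quasi_metric E mu p0 "Suc k" d \<beta>
    by unfold_locales (use d in auto)
  show ?thesis
    by (rule exI[of _ d], rule exI[of _ \<alpha>], rule exI[of _ \<beta>])
      (intro conjI metric fits quasisymmetric edge_length \<alpha>_bounds DHK ARL BRU VG)
qed

end
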